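(* Let $\mathbf{k}$ be a field, $G$ an abelian group, $S\subseteq G$ a submonoid whose only invertible element is the identity $e$, and suppose that the poset $G$ (with $a\le b$ iff $ba^{-1}\in S$) has products: any $b,c\in G$ have a greatest lower bound $b\times c$. Let $\mathcal{K}:\mathrm{cat}(\mathrm{Cay}(G,S))\to\mathbf{Simp}$ be a Cayley-persistence simplicial complex such that $H_*(\mathcal{K}_a;\mathbf{k})$ is finite dimensional for all $a\in G$, and let $\mathbf{H}=\bigoplus_{a\in G}H^{*}_{a}$ be the associated right $\mathbf{k}[\mathbb{L}_S]$-module with the persistence-cup product. Then the persistence-cup product on $\mathbf{H}$ is uniquely determined by the persistence-cup product of $\mathbf{k}[\mathbb{L}_{S}]$-module generators, and $(\mathbf{H},\cdot)$ is a $G$-graded $\mathbf{k}[\mathbb{L}_{S}]$-twisted algebra. That is: the persistence-cup product is associative, and there are bilinear functions $f_{a,b}:\mathbf{k}[\mathbb{L}_S]\times\mathbf{k}[\mathbb{L}_S]\to\mathbf{k}[\mathbb{L}_S]$ ($a,b\in G$) such that $(\alpha\cdot\lambda)\cdot(\beta\cdot\mu)=(\alpha\cdot\beta)\cdot f_{a,b}(\lambda,\mu)$ for all homogeneous $\alpha,\beta\in\mathbf{H}$ of degrees $a,b$ and all $\lambda,\mu\in\mathbf{k}[\mathbb{L}_S]$; consequently, for any family of homogeneous module generators $(g_i)$ of $\mathbf{H}$, with $g_i$ of degree $d_i$, the product of two arbitrary elements is given by the products $g_i\cdot g_j$ via $\left(\sum_i g_i\cdot\lambda_i\right)\cdot\left(\sum_j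 g_j\cdot\mu_j\right)=\sum_{i,j}(g_i\cdot g_j)\cdot f_{d_i,d_j}(\lambda_i,\mu_j)$ (finite sums).
   Context: $\mathrm{Cay}(G,S)$ is the digraph with vertex set $G$ and an arc $(a,b)$ whenever $ba^{-1}\in S$; $\mathrm{cat}(\mathrm{Cay}(G,S))$ has object set $G$, one morphism $a\to b$ if $ba^{-1}\in S$, and none otherwise; under the hypotheses it is the category of the poset $(G,\le)$. A Cayley-persistence simplicial complex is a functor $\mathcal{K}$ from this category to simplicial complexes. $H^*_a=H^*(\mathcal{K}_a;\mathbf{k})$ is reduced simplicial cohomology. For $x\in S$, $L_x:H^*_{xa}\to H^*_a$ ($a\in G$) is the map induced by $\mathcal{K}_a\to\mathcal{K}_{xa}$; it is regarded as a graded map on $\mathbf{H}$, remembered together with its degree $x$. $\mathbb{L}_S=\{L_x\}_{x\in S}$ is a monoid with $L_x\cdot L_y=L_y\circ L_x$ $(=L_{xy})$; $\mathbf{k}[\mathbb{L}_S]$ is its monoid ring, graded by $\deg L_x=x$. $\mathbf{H}$ is a right $\mathbf{k}[\mathbb{L}_S]$-module via $\alpha\cdot L_x=L_x(\alpha)$, $G$-graded by $\deg\alpha=a^{-1}$ for $\alpha\in H^*_a$. Persistence-cup product: for $\beta\in H^*_b$, $\gamma\in H^*_c$, $\beta\cdot\gamma=(L_{b(b\times c)^{-1}}\beta)\cup(L_{c(b\times c)^{-1}}\gamma)\in H^*_{b\times c}$, extended bilinearly to $\mathbf{H}$. For a commutative $G$-graded ring $R$, a $G$-graded $R$-twisted algebra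 is a $G$-graded $R$-module $A=\bigoplus_{a\in G}A_a$ with an associative multiplication $\cdot:A\times A\to A$ and bilinear functions $f_{a,b}:R\times R\to R$ ($a,b\in G$) such that $(\lambda\alpha)\cdot(\mu\beta)=f_{a,b}(\lambda,\mu)(\alpha\cdot\beta)$ for all $\lambda,\mu\in R$, $\alpha\in A_a$, $\beta\in A_b$. Here, for $R=\mathbf{k}[\mathbb{L}_S]$, bilinear means $\mathbf{k}$-bilinear.
   Formalization: The cup product on reduced cohomology is not well defined for classes of degree 0 (constants are coboundaries, but cupping with 1 is the identity); here it is set to zero whenever it is not induced by cochains, and is the usual cup product in positive degrees. *)

theory Defs
  imports "HOL-Algebra.Module" "HOL-Library.Poly_Mapping"
begin

section \<open>Twisted algebras over a graded ring\<close>

text \<open>The abelian group G is a type of class \<^class>\<open>ab_group_add\<close>, written additively: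
  the unit is 0, and \<open>b * inverse a\<close> becomes \<open>b - a\<close>.\<close>

definition internal_direct_sum :: "('m, 'x) ring_scheme \<Rightarrow> ('g \<Rightarrow> 'm set) \<Rightarrow> bool" where
  "internal_direct_sum M D \<longleftrightarrow>
     (\<forall>a. subgroup (D a) (add_monoid M)) \<and>
     (\<forall>m \<in> carrier M. \<exists>!c. (\<forall>a. c a \<in> D a) \<and> finite {a. c a \<noteq> \<zero>\<^bsub>M\<^esub>} \<and>
        m = (\<Oplus>\<^bsub>M\<^esub> a \<in> {a. c a \<noteq> \<zero>\<^bsub>M\<^esub>}. c a))"

definition graded_cring :: "('r, 'x) ring_scheme \<Rightarrow> ('g::ab_group_add \<Rightarrow> 'r set) \<Rightarrow> bool" where
  "graded_cring R Rg \<longleftrightarrow> cring R \<and> internal_direct_sum R Rg \<and> \<one>\<^bsub>R\<^esub> \<in> Rg 0 \<and>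
     (\<forall>x y. \<forall>r \<in> Rg x. \<forall>s \<in> Rg y. r \<otimes>\<^bsub>R\<^esub> s \<in> Rg (x + y))"

text \<open>As the base ring is commutative, a right module is the same as a module in the sense of
  \<^locale>\<open>module\<close>; the right action of r on m is \<open>r \<odot> m\<close>.\<close>

definition graded_module ::
  "('r, 'x) ring_scheme \<Rightarrow> ('g::ab_group_add \<Rightarrow> 'r set) \<Rightarrow> ('r, 'm, 'y) module_scheme \<Rightarrow>
   ('g \<Rightarrow> 'm set) \<Rightarrow> bool" where
  "graded_module R Rg A Ag \<longleftrightarrow> module R A \<and> internal_direct_sum A Ag \<and>
     (\<forall>x a. \<forall>r \<in> Rg x. \<forall>m \<in> Ag a. r \<odot>\<^bsub>A\<^esub> m \<in> Ag (a + x))"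

definition bilinear_over :: "('r, 'x) ring_scheme \<Rightarrow> 'r set \<Rightarrow> ('r \<Rightarrow> 'r \<Rightarrow> 'r) \<Rightarrow> bool" where
  "bilinear_over R k f \<longleftrightarrow>
     (\<forall>r \<in> carrier R. \<forall>s \<in> carrier R. f r s \<in> carrier R) \<and>
     (\<forall>r \<in> carrier R. \<forall>r' \<in> carrier R. \<forall>s \<in> carrier R.
        f (r \<oplus>\<^bsub>R\<^esub> r') s = f r s \<oplus>\<^bsub>R\<^esub> f r' s \<and> f s (r \<oplus>\<^bsub>R\<^esub> r') = f s r \<oplus>\<^bsub>R\<^esub> f s r') \<and>
     (\<forall>t \<in> k. \<forall>r \<in> carrier R. \<forall>s \<in> carrier R.
        f (t \<otimes>\<^bsub>R\<^esub> r) s = t \<otimes>\<^bsub>R\<^esub> f r s \<and> f r (t \<otimes>\<^bsub>R\<^esub> s) = t \<otimes>\<^bsub>R\<^esub> f r s)"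

text \<open>\<open>k\<close> is the subring of scalars of R over which the twisting functions are bilinear. The
  multiplication of the algebra A is the field \<^const>\<open>mult\<close> of its module record; A need not be
  unital, so the field \<^const>\<open>one\<close> of the record plays no role.\<close>

definition graded_twisted_algebra ::
  "('r, 'x) ring_scheme \<Rightarrow> 'r set \<Rightarrow> ('g::ab_group_add \<Rightarrow> 'r set) \<Rightarrow>
   ('r, 'm, 'y) module_scheme \<Rightarrow> ('g \<Rightarrow> 'm set) \<Rightarrow> ('g \<Rightarrow> 'g \<Rightarrow> 'r \<Rightarrow> 'r \<Rightarrow> 'r) \<Rightarrow> bool" where
  "graded_twisted_algebra R k Rg A Ag f \<longleftrightarrow>
     graded_cring R Rg \<and> graded_module R Rg A Ag \<and>
     (\<forall>u \<in> carrier A. \<forall>v \<in> carrier A. u \<otimes>\<^bsub>A\<^esub> v \<in> carrier A) \<and>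
     (\<forall>u \<in> carrier A. \<forall>v \<in> carrier A. \<forall>w \<in> carrier A.
        (u \<oplus>\<^bsub>A\<^esub> v) \<otimes>\<^bsub>A\<^esub> w = (u \<otimes>\<^bsub>A\<^esub> w) \<oplus>\<^bsub>A\<^esub> (v \<otimes>\<^bsub>A\<^esub> w) \<and>
        w \<otimes>\<^bsub>A\<^esub> (u \<oplus>\<^bsub>A\<^esub> v) = (w \<otimes>\<^bsub>A\<^esub> u) \<oplus>\<^bsub>A\<^esub> (w \<otimes>\<^bsub>A\<^esub> v)) \<and>
     (\<forall>u \<in> carrier A. \<forall>v \<in> carrier A. \<forall>w \<in> carrier A.
        (u \<otimes>\<^bsub>A\<^esub> v) \<otimes>\<^bsub>A\<^esub> w = u \<otimes>\<^bsub>A\<^esub> (v \<otimes>\<^bsub>A\<^esub> w)) \<and>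
     (\<forall>a b. bilinear_over R k (f a b)) \<and>
     (\<forall>a b. \<forall>u \<in> Ag a. \<forall>v \<in> Ag b. \<forall>r \<in> carrier R. \<forall>s \<in> carrier R.
        (r \<odot>\<^bsub>A\<^esub> u) \<otimes>\<^bsub>A\<^esub> (s \<odot>\<^bsub>A\<^esub> v) = f a b r s \<odot>\<^bsub>A\<^esub> (u \<otimes>\<^bsub>A\<^esub> v))"

definition module_generators ::
  "('r, 'x) ring_scheme \<Rightarrow> ('r, 'm, 'y) module_scheme \<Rightarrow> 'i set \<Rightarrow> ('i \<Rightarrow> 'm) \<Rightarrow> bool" where
  "module_generators R A I g \<longleftrightarrow> g \<in> I \<rightarrow> carrier A \<and>
     (\<forall>m \<in> carrier A. \<exists>J r. finite J \<and> J \<subseteq> I \<and> r \<in> J \<rightarrow> carrier R \<and>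
        m = (\<Oplus>\<^bsub>A\<^esub> i \<in> J. r i \<odot>\<^bsub>A\<^esub> g i))"


section \<open>Cayley-persistence simplicial complexes\<close>

definition cay_le :: "'g::ab_group_add set \<Rightarrow> 'g \<Rightarrow> 'g \<Rightarrow> bool" where
  "cay_le S a b \<longleftrightarrow> b - a \<in> S"

definition is_cay_product :: "'g::ab_group_add set \<Rightarrow> 'g \<Rightarrow> 'g \<Rightarrow> 'g \<Rightarrow> bool" where
  "is_cay_product S b c m \<longleftrightarrow> cay_le S m b \<and> cay_le S m c \<and>
     (\<forall>l. cay_le S l b \<and> cay_le S l c \<longrightarrow> cay_le S l m)"

definition cay_product :: "'g::ab_group_add set \<Rightarrow> 'g \<Rightarrow> 'g \<Rightarrow> 'g" where
  "cay_product S b c = (THE m. is_cay_product S b c m)"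

definition simplicial_complex :: "'v set set \<Rightarrow> bool" where
  "simplicial_complex K \<longleftrightarrow> (\<forall>\<sigma> \<in> K. finite \<sigma> \<and> \<sigma> \<noteq> {} \<and> (\<forall>\<tau>. \<tau> \<subseteq> \<sigma> \<and> \<tau> \<noteq> {} \<longrightarrow> \<tau> \<in> K))"

definition simplicial_map :: "'v set set \<Rightarrow> 'v set set \<Rightarrow> ('v \<Rightarrow> 'v) \<Rightarrow> bool" where
  "simplicial_map K L f \<longleftrightarrow> (\<forall>\<sigma> \<in> K. f ` \<sigma> \<in> L)"

text \<open>A functor from cat(Cay(G,S)) to simplicial complexes: \<open>\<phi> a b\<close> is the vertex map of
  \<open>K a \<rightarrow> K b\<close> for \<open>a \<le> b\<close>; its values off the vertices of \<open>K a\<close> are irrelevant. The common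
  vertex type \<open>'v\<close> is arbitrary and the complexes need not be nested.\<close>

definition cayley_persistence_complex ::
  "'g::ab_group_add set \<Rightarrow> ('g \<Rightarrow> 'v set set) \<Rightarrow> ('g \<Rightarrow> 'g \<Rightarrow> 'v \<Rightarrow> 'v) \<Rightarrow> bool" where
  "cayley_persistence_complex S K \<phi> \<longleftrightarrow>
     (\<forall>a. simplicial_complex (K a)) \<and>
     (\<forall>a b. cay_le S a b \<longrightarrow> simplicial_map (K a) (K b) (\<phi> a b)) \<and>
     (\<forall>a. \<forall>v \<in> \<Union>(K a). \<phi> a a v = v) \<and>
     (\<forall>a b c. cay_le S a b \<and> cay_le S b c \<longrightarrow>
        (\<forall>v \<in> \<Union>(K a). \<phi> a c v = \<phi> b c (\<phi> a b v)))"


section \<open>Reduced simplicial homology and cohomology\<close>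

text \<open>Homology and cohomology are those of the augmented ordered chain complex: an ordered
  n-simplex is a list of n+1 vertices, possibly with repetitions, whose set is a simplex, and the
  empty list spans degree -1. Ordered cochains need no choice of vertex orderings, and simplicial
  maps respect the front-face/back-face formula for the cup product strictly.\<close>

definition ordered_simplices :: "'v set set \<Rightarrow> int \<Rightarrow> 'v list set" where
  "ordered_simplices K n = {vs. int (length vs) = n + 1 \<and> (vs = [] \<or> set vs \<in> K)}"

definition face :: "nat \<Rightarrow> 'v list \<Rightarrow> 'v list" where
  "face i vs = take i vs @ drop (Suc i) vs"

definition chains :: "'v set set \<Rightarrow> ('v list \<Rightarrow>\<^sub>0 'k::field) set" where
  "chains K = {c. Poly_Mapping.keys c \<subseteq> (\<Union>n. ordered_simplices K n)}"

definition boundary :: "('v list \<Rightarrow>\<^sub>0 'k::field) \<Rightarrow> ('v list \<Rightarrow>\<^sub>0 'k)" where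
  "boundary c = (\<Sum>vs \<in> Poly_Mapping.keys c. \<Sum>i < length vs.
     Poly_Mapping.single (face i vs) ((- 1) ^ i * Poly_Mapping.lookup c vs))"

text \<open>Total homology (the direct sum over all degrees) is spanned over k by the classes of
  finitely many cycles. Homology determines no value of type \<open>'k\<close>, so the field is passed as a
  type argument.\<close>

definition finite_dimensional_homology :: "'k::field itself \<Rightarrow> 'v set set \<Rightarrow> bool" where
  "finite_dimensional_homology k K \<longleftrightarrow>
     (\<exists>F \<subseteq> {c \<in> chains K :: ('v list \<Rightarrow>\<^sub>0 'k) set. boundary c = 0}. finite F \<and>
        (\<forall>z \<in> chains K. boundary z = 0 \<longrightarrow>
           (\<exists>u :: ('v list \<Rightarrow>\<^sub>0 'k) \<Rightarrow> 'k.
              z - (\<Sum>c \<in> F. Poly_Mapping.map ((*) (u c)) c) \<in> boundary ` chains K)))"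

definition cochains :: "'v set set \<Rightarrow> int \<Rightarrow> ('v list \<Rightarrow> 'k::field) set" where
  "cochains K n = {c. \<forall>vs. vs \<notin> ordered_simplices K n \<longrightarrow> c vs = 0}"

definition coboundary :: "'v set set \<Rightarrow> int \<Rightarrow> ('v list \<Rightarrow> 'k::field) \<Rightarrow> ('v list \<Rightarrow> 'k)" where
  "coboundary K n c = (\<lambda>vs. if vs \<in> ordered_simplices K (n + 1)
     then (\<Sum>i < length vs. (- 1) ^ i * c (face i vs)) else 0)"

definition cocycles :: "'v set set \<Rightarrow> int \<Rightarrow> ('v list \<Rightarrow> 'k::field) set" where
  "cocycles K n = {c \<in> cochains K n. coboundary K n c = (\<lambda>_. 0)}"

definition coboundaries :: "'v set set \<Rightarrow> int \<Rightarrow> ('v list \<Rightarrow> 'k::field) set" where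
  "coboundaries K n = coboundary K (n - 1) ` cochains K (n - 1)"

text \<open>Cohomology classes are cosets of the coboundaries; in particular the zero class is
  \<^term>\<open>coboundaries K n\<close>.\<close>

definition cohomology :: "'v set set \<Rightarrow> int \<Rightarrow> ('v list \<Rightarrow> 'k::field) set set" where
  "cohomology K n = (\<lambda>z. {\<lambda>vs. z vs + e vs | e. e \<in> coboundaries K n}) ` cocycles K n"

definition class_add ::
  "('v list \<Rightarrow> 'k::field) set \<Rightarrow> ('v list \<Rightarrow> 'k) set \<Rightarrow> ('v list \<Rightarrow> 'k) set" where
  "class_add X Y = {\<lambda>vs. c vs + d vs | c d. c \<in> X \<and> d \<in> Y}"

definition class_scale ::
  "'v set set \<Rightarrow> int \<Rightarrow> 'k::field \<Rightarrow> ('v list \<Rightarrow> 'k) set \<Rightarrow> ('v list \<Rightarrow> 'k) set" where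
  "class_scale K n t X = {\<lambda>vs. t * c vs + e vs | c e. c \<in> X \<and> e \<in> coboundaries K n}"

text \<open>The map induced in degree n by a simplicial map with vertex map f and source K.\<close>

definition pullback ::
  "'v set set \<Rightarrow> int \<Rightarrow> ('v \<Rightarrow> 'v) \<Rightarrow> ('v list \<Rightarrow> 'k::field) \<Rightarrow> ('v list \<Rightarrow> 'k)" where
  "pullback K n f c = (\<lambda>vs. if vs \<in> ordered_simplices K n then c (map f vs) else 0)"

definition induced ::
  "'v set set \<Rightarrow> int \<Rightarrow> ('v \<Rightarrow> 'v) \<Rightarrow> ('v list \<Rightarrow> 'k::field) set \<Rightarrow> ('v list \<Rightarrow> 'k) set" where
  "induced K n f X = {\<lambda>vs. pullback K n f c vs + e vs | c e. c \<in> X \<and> e \<in> coboundaries K n}"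

text \<open>The cup product of a p-cochain c and a q-cochain d; it is 0 if p or q is -1, because then c
  or d is evaluated on a list of the wrong length.\<close>

definition cochain_cup ::
  "'v set set \<Rightarrow> int \<Rightarrow> int \<Rightarrow> ('v list \<Rightarrow> 'k::field) \<Rightarrow> ('v list \<Rightarrow> 'k) \<Rightarrow> ('v list \<Rightarrow> 'k)" where
  "cochain_cup K p q c d = (\<lambda>vs. if vs \<in> ordered_simplices K (p + q)
     then c (take (nat (p + 1)) vs) * d (drop (nat p) vs) else 0)"

text \<open>The cup product of classes X and Y is the class consisting of the products of their
  representatives. For p and q positive these products always form a class. In degree 0, however,
  the reduced theory needs a convention: the constant 0-cochains are coboundaries of the augmented
  complex, and cup product with the constant 1 is the identity, so changing a representative of a
  degree 0 class by 1 changes its product with d by d. Whenever the products of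
  representatives do not form a single class, the cup product is 0. This makes the cup product
  bilinear and natural; if p = 0 or q = 0 and the products of representatives do form a class, then
  that class is 0 as well. Nothing is lost on a connected complex, whose reduced cohomology
  vanishes in degree 0.\<close>

definition class_cup ::
  "'v set set \<Rightarrow> int \<Rightarrow> int \<Rightarrow> ('v list \<Rightarrow> 'k::field) set \<Rightarrow> ('v list \<Rightarrow> 'k) set \<Rightarrow>
   ('v list \<Rightarrow> 'k) set" where
  "class_cup K p q X Y =
     (let Z = {\<lambda>vs. cochain_cup K p q c d vs + e vs | c d e.
                 c \<in> X \<and> d \<in> Y \<and> e \<in> coboundaries K (p + q)}
      in if Z \<in> cohomology K (p + q) then Z else coboundaries K (p + q))"


section \<open>The persistence module and the persistence-cup product\<close>

text \<open>The monoid consisting of the \<open>L\<^sub>x\<close>, each remembered together with its degree x in S, is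
  identified with S by taking degrees. Its monoid ring thus consists of the finitely supported
  functions on S, multiplied by convolution, which is the multiplication of the type of finitely
  supported functions on G.\<close>

definition persistence_ring :: "'g::ab_group_add set \<Rightarrow> ('g \<Rightarrow>\<^sub>0 'k::field) ring" where
  "persistence_ring S = \<lparr>carrier = {r. Poly_Mapping.keys r \<subseteq> S}, mult = (*), one = 1,
     zero = 0, add = (+)\<rparr>"

definition persistence_ring_degree ::
  "'g::ab_group_add set \<Rightarrow> 'g \<Rightarrow> ('g \<Rightarrow>\<^sub>0 'k::field) set" where
  "persistence_ring_degree S x = {r \<in> carrier (persistence_ring S). Poly_Mapping.keys r \<subseteq> {x}}"

definition persistence_ring_scalars :: "('g::ab_group_add \<Rightarrow>\<^sub>0 'k::field) set" where
  "persistence_ring_scalars = range (Poly_Mapping.single 0)"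

text \<open>The direct sum of the \<open>H\<^sup>n(K a)\<close> over all a and n: \<open>h a n\<close> is the component of h in
  \<open>H\<^sup>n(K a)\<close>. Only the additive structure of this record is meaningful.\<close>

type_synonym ('g, 'v, 'k) coh = "'g \<Rightarrow> int \<Rightarrow> ('v list \<Rightarrow> 'k) set"

definition coh_support ::
  "('g \<Rightarrow> 'v set set) \<Rightarrow> ('g, 'v, 'k::field) coh \<Rightarrow> ('g \<times> int) set" where
  "coh_support K h = {(a, n). h a n \<noteq> coboundaries (K a) n}"

definition coh_group :: "('g \<Rightarrow> 'v set set) \<Rightarrow> (('g, 'v, 'k::field) coh) ring" where
  "coh_group K =
     \<lparr>carrier = {h. (\<forall>a n. h a n \<in> cohomology (K a) n) \<and> finite (coh_support K h)},
      mult = undefined, one = undefined,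
      zero = (\<lambda>a n. coboundaries (K a) n),
      add = (\<lambda>h h' a n. class_add (h a n) (h' a n))\<rparr>"

definition coh_inject ::
  "('g \<Rightarrow> 'v set set) \<Rightarrow> 'g \<Rightarrow> int \<Rightarrow> ('v list \<Rightarrow> 'k::field) set \<Rightarrow> ('g, 'v, 'k) coh" where
  "coh_inject K a n X = (\<lambda>b m. if b = a \<and> m = n then X else coboundaries (K b) m)"

definition persist ::
  "('g::ab_group_add \<Rightarrow> 'v set set) \<Rightarrow> ('g \<Rightarrow> 'g \<Rightarrow> 'v \<Rightarrow> 'v) \<Rightarrow> 'g \<Rightarrow> ('g, 'v, 'k::field) coh \<Rightarrow>
   ('g, 'v, 'k) coh" where
  "persist K \<phi> x h = (\<lambda>a n. induced (K a) n (\<phi> a (x + a)) (h (x + a) n))"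

definition coh_scale ::
  "('g \<Rightarrow> 'v set set) \<Rightarrow> 'k::field \<Rightarrow> ('g, 'v, 'k) coh \<Rightarrow> ('g, 'v, 'k) coh" where
  "coh_scale K t h = (\<lambda>a n. class_scale (K a) n t (h a n))"

definition coh_action ::
  "('g::ab_group_add \<Rightarrow> 'v set set) \<Rightarrow> ('g \<Rightarrow> 'g \<Rightarrow> 'v \<Rightarrow> 'v) \<Rightarrow> ('g \<Rightarrow>\<^sub>0 'k::field) \<Rightarrow>
   ('g, 'v, 'k) coh \<Rightarrow> ('g, 'v, 'k) coh" where
  "coh_action K \<phi> r h = (\<Oplus>\<^bsub>coh_group K\<^esub> x \<in> Poly_Mapping.keys r.
     coh_scale K (Poly_Mapping.lookup r x) (persist K \<phi> x h))"

text \<open>The product of X in \<open>H\<^sup>p(K b)\<close> and Y in \<open>H\<^sup>q(K c)\<close>. With m the product of b and c in the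
  poset, the classes are first moved to \<open>K m\<close> by \<open>L\<^bsub>b-m\<^esub>\<close> and \<open>L\<^bsub>c-m\<^esub>\<close>, i.e.\ along the maps
  \<open>K m \<rightarrow> K b\<close> and \<open>K m \<rightarrow> K c\<close>.\<close>

definition persistence_cup_class ::
  "'g::ab_group_add set \<Rightarrow> ('g \<Rightarrow> 'v set set) \<Rightarrow> ('g \<Rightarrow> 'g \<Rightarrow> 'v \<Rightarrow> 'v) \<Rightarrow> 'g \<Rightarrow> int \<Rightarrow> 'g \<Rightarrow> int \<Rightarrow>
   ('v list \<Rightarrow> 'k::field) set \<Rightarrow> ('v list \<Rightarrow> 'k) set \<Rightarrow> ('v list \<Rightarrow> 'k) set" where
  "persistence_cup_class S K \<phi> b p c q X Y =
     (let m = cay_product S b c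
      in class_cup (K m) p q (induced (K m) p (\<phi> m b) X) (induced (K m) q (\<phi> m c) Y))"

definition persistence_cup ::
  "'g::ab_group_add set \<Rightarrow> ('g \<Rightarrow> 'v set set) \<Rightarrow> ('g \<Rightarrow> 'g \<Rightarrow> 'v \<Rightarrow> 'v) \<Rightarrow>
   ('g, 'v, 'k::field) coh \<Rightarrow> ('g, 'v, 'k) coh \<Rightarrow> ('g, 'v, 'k) coh" where
  "persistence_cup S K \<phi> h h' =
     (\<Oplus>\<^bsub>coh_group K\<^esub> ij \<in> coh_support K h \<times> coh_support K h'.
        case ij of ((b, p), (c, q)) \<Rightarrow> coh_inject K (cay_product S b c) (p + q)
          (persistence_cup_class S K \<phi> b p c q (h b p) (h' c q)))"

definition persistence_cohomology ::
  "'g::ab_group_add set \<Rightarrow> ('g \<Rightarrow> 'v set set) \<Rightarrow> ('g \<Rightarrow> 'g \<Rightarrow> 'v \<Rightarrow> 'v) \<Rightarrow>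
   ('g \<Rightarrow>\<^sub>0 'k::field, ('g, 'v, 'k) coh) module" where
  "persistence_cohomology S K \<phi> =
     \<lparr>carrier = carrier (coh_group K), mult = persistence_cup S K \<phi>, one = undefined,
      zero = \<zero>\<^bsub>coh_group K\<^esub>, add = add (coh_group K), smult = coh_action K \<phi>\<rparr>"

text \<open>Classes in \<open>H\<^sup>*(K a)\<close> have degree \<open>- a\<close>.\<close>

definition persistence_degree ::
  "('g::ab_group_add \<Rightarrow> 'v set set) \<Rightarrow> 'g \<Rightarrow> (('g, 'v, 'k::field) coh) set" where
  "persistence_degree K d =
     {h \<in> carrier (coh_group K). \<forall>a n. a \<noteq> - d \<longrightarrow> h a n = coboundaries (K a) n}"

end

theory Submission
  imports Defs
begin

text \<open>Everything is additive in each argument, so it suffices to compare both sides on classes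
  \<open>\<alpha> \<in> H\<^sup>p(K a)\<close>, \<open>\<beta> \<in> H\<^sup>q(K b)\<close> and on the basis elements \<open>L\<^sub>x\<close> of the ring. There
  associativity and the twisting law follow from functoriality of cohomology, naturality of the cup
  product and monotonicity of the meet: \<open>L\<^sub>x \<alpha> \<cdot> L\<^sub>y \<beta>\<close> and \<open>\<alpha> \<cdot> \<beta>\<close> are restrictions of the same
  classes, the former to the meet of \<open>a - x\<close> and \<open>b - y\<close>, the latter to the larger meet of a and b.
  So they differ by \<open>L\<^sub>z\<close> for z the difference of the two meets, which depends only on a, b, x, y.\<close>

section \<open>Cup products of ordered cochains\<close>

text \<open>The obstacle is reduced cohomology in low degrees. The Leibniz rule fails when a factor
  has degree -1, so products of representatives of degree 0 classes need not form a class.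
  \<open>class_cup_trivial\<close> settles this once and for all: as soon as one degree is not
  positive, the product is the zero class. Each law of the cup product then splits into positive
  degrees, where representatives are multiplied, and a case in which both sides vanish. Ordered
  simplices may repeat vertices. Hence naturality and associativity already hold strictly for
  cochains, and no chain homotopies occur. The twisting functions are only \<open>k\<close>-bilinear
  and not given by multiplication in the ring. For the natural numbers inside the integers the meet
  is the minimum, and in degrees a = b = 0 the pair \<open>L_x\<close>, \<open>L_y\<close> is sent
  to \<open>L_z\<close> with z = max x y, which is not determined by x + y. They are therefore built
  as a double sum over basis elements.\<close>

definition alt_sum :: "('v list \<Rightarrow> 'k::field) \<Rightarrow> 'v list \<Rightarrow> 'k" where
  "alt_sum c vs = (\<Sum>i<length vs. (- 1) ^ i * c (face i vs))"

lemma alt_sum_Nil [simp]: "alt_sum c [] = 0"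
  by (simp add: alt_sum_def)

text \<open>This recursion turns \<open>\<delta>\<delta> = 0\<close> and the Leibniz rule into short list inductions, without any
  manipulation of double sums over faces.\<close>

lemma alt_sum_Cons: "alt_sum c (v # vs) = c vs - alt_sum (\<lambda>us. c (v # us)) vs"
  by (simp add: alt_sum_def face_def sum.lessThan_Suc_shift sum_negf del: sum.lessThan_Suc)

lemma alt_sum_lincomb:
  "alt_sum (\<lambda>us. s * c us + t * d us) vs = s * alt_sum c vs + t * alt_sum d vs"
  by (simp add: alt_sum_def sum.distrib sum_distrib_left algebra_simps)

lemma alt_sum_diff: "alt_sum (\<lambda>us. c us - d us) vs = alt_sum c vs - alt_sum d vs"
  using alt_sum_lincomb[of 1 c "-1" d vs] by simp

lemma alt_sum_scale: "alt_sum (\<lambda>us. s * c us) vs = s * alt_sum c vs"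
  using alt_sum_lincomb[of s c 0 c vs] by simp

lemma alt_sum_cong:
  "(\<And>i. i < length vs \<Longrightarrow> c (face i vs) = d (face i vs)) \<Longrightarrow> alt_sum c vs = alt_sum d vs"
  by (simp add: alt_sum_def)

text \<open>In the recursion the terms \<open>alt_sum c vs\<close> cancel. What remains is the same
  double sum for \<open>\<lambda>us. c (v # us)\<close>, which is why \<open>c\<close> is
  generalised.\<close>

lemma alt_sum_alt_sum: "alt_sum (alt_sum c) vs = 0"
proof (induction vs arbitrary: c)
  case (Cons v vs)
  then show ?case by (simp add: alt_sum_Cons alt_sum_diff)
qed simp

text \<open>The right side has two terms more than the left: the last face of the front part and the
  first face of the back part. They carry opposite signs and cancel. The induction moves the head of
  the list into \<open>c\<close>.\<close>

lemma alt_sum_cup: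
  assumes "p + 2 \<le> length vs"
  shows "alt_sum (\<lambda>us. c (take (Suc p) us) * d (drop p us)) vs =
    alt_sum c (take (p + 2) vs) * d (drop (Suc p) vs) +
    (- 1) ^ p * (c (take (Suc p) vs) * alt_sum d (drop p vs))"
  using assms
proof (induction p arbitrary: c vs)
  case 0
  then obtain v w ws where vs: "vs = v # w # ws"
    by (auto simp: Suc_le_length_iff numeral_2_eq_2)
  \<comment> \<open>With the head fixed, the factor \<open>c [v]\<close> no longer depends on the
    face and leaves the sum before the next unfolding.\<close>
  show ?case unfolding vs
    by (simp add: alt_sum_Cons[of _ v] alt_sum_scale) (simp add: alt_sum_Cons algebra_simps)
next
  case (Suc p)
  then obtain v ws where vs: "vs = v # ws" and l: "p + 2 \<le> length ws"
    by (auto simp: Suc_le_length_iff)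
  show ?case unfolding vs using Suc.IH[OF l, of "\<lambda>us. c (v # us)"]
    by (simp add: alt_sum_Cons algebra_simps)
qed

section \<open>Cochains, cocycles and coboundaries of a complex\<close>

lemma ordered_simplices_mono:
  assumes "simplicial_complex K" "vs \<in> ordered_simplices K n" "set us \<subseteq> set vs"
    "int (length us) = m + 1"
  shows "us \<in> ordered_simplices K m"
  using assms by (cases "us = []") (auto simp: ordered_simplices_def simplicial_complex_def)

lemma face_ordered_simplices:
  assumes "simplicial_complex K" "vs \<in> ordered_simplices K (n + 1)" "i < length vs"
  shows "face i vs \<in> ordered_simplices K n"
  using assms(1,2)
proof (rule ordered_simplices_mono)
  show "set (face i vs) \<subseteq> set vs"
    by (auto simp: face_def dest: in_set_takeD in_set_dropD)
  show "int (length (face i vs)) = n + 1"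
    using assms(2,3) by (auto simp: face_def ordered_simplices_def)
qed

lemma coboundary_eq:
  "coboundary K n c = (\<lambda>vs. if vs \<in> ordered_simplices K (n + 1) then alt_sum c vs else 0)"
  unfolding coboundary_def alt_sum_def ..

lemma coboundary_lincomb:
  "coboundary K n (\<lambda>vs. s * c vs + t * d vs) =
    (\<lambda>vs. s * coboundary K n c vs + t * coboundary K n d vs)"
  by (rule ext) (simp add: coboundary_eq alt_sum_lincomb)

lemma coboundary_coboundary:
  assumes "simplicial_complex K"
  shows "coboundary K (n + 1) (coboundary K n c) = (\<lambda>_. 0)"
proof
  fix vs
  \<comment> \<open>\<open>coboundary\<close> is cut off outside the ordered simplices, which is
    invisible here because only faces of an ordered simplex are evaluated.\<close>
  have "alt_sum (coboundary K n c) vs = alt_sum (alt_sum c) vs"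
    if "vs \<in> ordered_simplices K (n + 1 + 1)"
    by (intro alt_sum_cong) (use face_ordered_simplices[OF assms that] in \<open>simp add: coboundary_eq\<close>)
  then show "coboundary K (n + 1) (coboundary K n c) vs = 0"
    by (simp add: coboundary_eq[of K "n + 1"] alt_sum_alt_sum)
qed

lemma cochains_lincomb:
  "c \<in> cochains K n \<Longrightarrow> d \<in> cochains K n \<Longrightarrow> (\<lambda>vs. s * c vs + t * d vs) \<in> cochains K n"
  by (simp add: cochains_def)

lemma cocycles_lincomb:
  "c \<in> cocycles K n \<Longrightarrow> d \<in> cocycles K n \<Longrightarrow> (\<lambda>vs. s * c vs + t * d vs) \<in> cocycles K n"
  by (simp add: cocycles_def cochains_lincomb coboundary_lincomb)

lemma coboundaries_lincomb:
  "c \<in> coboundaries K n \<Longrightarrow> d \<in> coboundaries K n \<Longrightarrow>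
    (\<lambda>vs. s * c vs + t * d vs) \<in> coboundaries K n"
  unfolding coboundaries_def
  by (auto simp: coboundary_lincomb[symmetric] intro!: imageI cochains_lincomb)

lemma zero_cocycles: "(\<lambda>_. 0) \<in> cocycles K n"
  by (simp add: cocycles_def cochains_def coboundary_def fun_eq_iff)

lemma zero_coboundaries: "(\<lambda>_. 0) \<in> coboundaries K n"
  unfolding coboundaries_def
  by (rule image_eqI[of _ _ "\<lambda>_. 0"]) (auto simp: coboundary_def cochains_def)

lemma cocycles_add:
  "c \<in> cocycles K n \<Longrightarrow> d \<in> cocycles K n \<Longrightarrow> (\<lambda>vs. c vs + d vs) \<in> cocycles K n"
  using cocycles_lincomb[of c K n d 1 1] by simp

lemma cocycles_scale: "c \<in> cocycles K n \<Longrightarrow> (\<lambda>vs. t * c vs) \<in> cocycles K n"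
  using cocycles_lincomb[of c K n c t 0] by simp

lemma coboundaries_add:
  "c \<in> coboundaries K n \<Longrightarrow> d \<in> coboundaries K n \<Longrightarrow> (\<lambda>vs. c vs + d vs) \<in> coboundaries K n"
  using coboundaries_lincomb[of c K n d 1 1] by simp

lemma coboundaries_diff:
  "c \<in> coboundaries K n \<Longrightarrow> d \<in> coboundaries K n \<Longrightarrow> (\<lambda>vs. c vs - d vs) \<in> coboundaries K n"
  using coboundaries_lincomb[of c K n d 1 "-1"] by simp

lemma coboundaries_scale: "c \<in> coboundaries K n \<Longrightarrow> (\<lambda>vs. t * c vs) \<in> coboundaries K n"
  using coboundaries_lincomb[of c K n c t 0] by simp

lemma coboundaries_subset_cocycles:
  assumes "simplicial_complex K" "c \<in> coboundaries K n"
  shows "c \<in> cocycles K n"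
proof -
  obtain e where "c = coboundary K (n - 1) e" using assms(2) by (auto simp: coboundaries_def)
  then show ?thesis
    using coboundary_coboundary[OF assms(1), of "n - 1" e]
    by (simp add: cocycles_def cochains_def) (simp add: coboundary_def)
qed

section \<open>Cohomology classes as cosets\<close>

definition cls :: "'v set set \<Rightarrow> int \<Rightarrow> ('v list \<Rightarrow> 'k::field) \<Rightarrow> ('v list \<Rightarrow> 'k) set" where
  "cls K n z = {\<lambda>vs. z vs + e vs | e. e \<in> coboundaries K n}"

text \<open>Reduces equalities of classes and all operations on them to differences of
  representatives.\<close>

lemma mem_cls_iff: "x \<in> cls K n z \<longleftrightarrow> (\<lambda>vs. x vs - z vs) \<in> coboundaries K n"
proof
  assume "(\<lambda>vs. x vs - z vs) \<in> coboundaries K n"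
  then show "x \<in> cls K n z"
    unfolding cls_def by (intro CollectI exI[of _ "\<lambda>vs. x vs - z vs"]) simp
qed (auto simp: cls_def)

lemma cohomology_eq: "cohomology K n = cls K n ` cocycles K n"
  by (simp add: cohomology_def cls_def)

lemma cls_in_cohomology: "z \<in> cocycles K n \<Longrightarrow> cls K n z \<in> cohomology K n"
  by (simp add: cohomology_eq)

lemma cohomologyE:
  assumes "X \<in> cohomology K n"
  obtains z where "z \<in> cocycles K n" "X = cls K n z"
  using assms by (auto simp: cohomology_eq)

lemma cls_eqI:
  assumes "(\<lambda>vs. z vs - w vs) \<in> coboundaries K n"
  shows "cls K n z = cls K n w"
proof (rule Set.set_eqI)
  fix x
  show "x \<in> cls K n z \<longleftrightarrow> x \<in> cls K n w"
    using coboundaries_add[OF _ assms, of "\<lambda>vs. x vs - z vs"]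
      coboundaries_diff[OF _ assms, of "\<lambda>vs. x vs - w vs"]
    by (auto simp: mem_cls_iff)
qed

lemma coboundaries_eq_cls: "coboundaries K n = cls K n (\<lambda>_. 0)"
  by (auto simp: mem_cls_iff)

lemma coboundaries_in_cohomology: "coboundaries K n \<in> cohomology K n"
  unfolding coboundaries_eq_cls by (intro cls_in_cohomology zero_cocycles)

lemma class_add_cls: "class_add (cls K n z) (cls K n w) = cls K n (\<lambda>vs. z vs + w vs)"
proof (intro equalityI subsetI)
  fix x assume "x \<in> class_add (cls K n z) (cls K n w)"
  then obtain c d where "x = (\<lambda>vs. c vs + d vs)" "c \<in> cls K n z" "d \<in> cls K n w"
    by (auto simp: class_add_def)
  then show "x \<in> cls K n (\<lambda>vs. z vs + w vs)"
    using coboundaries_add[of "\<lambda>vs. c vs - z vs" K n "\<lambda>vs. d vs - w vs"]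
    by (simp add: mem_cls_iff algebra_simps)
next
  fix x assume "x \<in> cls K n (\<lambda>vs. z vs + w vs)"
  then show "x \<in> class_add (cls K n z) (cls K n w)"
    unfolding class_add_def using zero_coboundaries[of K n]
    by (intro CollectI exI[of _ z] exI[of _ "\<lambda>vs. x vs - z vs"])
      (simp add: mem_cls_iff algebra_simps)
qed

lemma class_scale_cls: "class_scale K n t (cls K n z) = cls K n (\<lambda>vs. t * z vs)"
proof (intro equalityI subsetI)
  fix x assume "x \<in> class_scale K n t (cls K n z)"
  then obtain c e where "x = (\<lambda>vs. t * c vs + e vs)" "c \<in> cls K n z" "e \<in> coboundaries K n"
    by (auto simp: class_scale_def)
  then show "x \<in> cls K n (\<lambda>vs. t * z vs)"
    using coboundaries_lincomb[of "\<lambda>vs. c vs - z vs" K n e t 1]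
    by (simp add: mem_cls_iff algebra_simps)
next
  fix x assume "x \<in> cls K n (\<lambda>vs. t * z vs)"
  then show "x \<in> class_scale K n t (cls K n z)"
    unfolding class_scale_def using zero_coboundaries[of K n]
    by (intro CollectI exI[of _ z] exI[of _ "\<lambda>vs. x vs - t * z vs"])
      (simp add: mem_cls_iff algebra_simps)
qed

section \<open>Pullback along simplicial maps\<close>

lemma map_ordered_simplices:
  assumes "simplicial_map K L f" "vs \<in> ordered_simplices K n"
  shows "map f vs \<in> ordered_simplices L n"
  using assms by (auto simp: simplicial_map_def ordered_simplices_def)

lemma alt_sum_map: "alt_sum c (map f vs) = alt_sum (\<lambda>us. c (map f us)) vs"
  by (simp add: alt_sum_def face_def take_map drop_map)

text \<open>A collapsed simplex becomes a list with repetitions, which is still an ordered simplex,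
  so degenerate images need no case of their own.\<close>

lemma coboundary_pullback:
  assumes "simplicial_complex K" "simplicial_map K L f"
  shows "coboundary K n (pullback K n f c) = pullback K (n + 1) f (coboundary L n c)"
proof
  fix vs
  have "alt_sum (pullback K n f c) vs = alt_sum (\<lambda>us. c (map f us)) vs"
    if "vs \<in> ordered_simplices K (n + 1)"
    by (intro alt_sum_cong)
      (use face_ordered_simplices[OF assms(1) that] in \<open>simp add: pullback_def\<close>)
  then show "coboundary K n (pullback K n f c) vs = pullback K (n + 1) f (coboundary L n c) vs"
    using map_ordered_simplices[OF assms(2)]
    by (auto simp: coboundary_eq alt_sum_map pullback_def[of K "n + 1"])
qed

lemma pullback_cochains: "pullback K n f c \<in> cochains K n"
  by (simp add: pullback_def cochains_def)

lemma pullback_lincomb: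
  "pullback K n f (\<lambda>vs. s * c vs + t * d vs) =
    (\<lambda>vs. s * pullback K n f c vs + t * pullback K n f d vs)"
  by (simp add: pullback_def fun_eq_iff)

lemma pullback_cocycles:
  assumes "simplicial_complex K" "simplicial_map K L f" "c \<in> cocycles L n"
  shows "pullback K n f c \<in> cocycles K n"
  using assms by (simp add: cocycles_def pullback_cochains coboundary_pullback)
    (simp add: pullback_def)

lemma pullback_coboundaries:
  assumes "simplicial_complex K" "simplicial_map K L f" "c \<in> coboundaries L n"
  shows "pullback K n f c \<in> coboundaries K n"
proof -
  obtain e where "c = coboundary L (n - 1) e" using assms(3) by (auto simp: coboundaries_def)
  then show ?thesis
    using coboundary_pullback[OF assms(1,2), of "n - 1" e]
    by (simp add: coboundaries_def) (metis image_eqI pullback_cochains)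
qed

lemma induced_cls:
  assumes "simplicial_complex K" "simplicial_map K L f"
  shows "induced K n f (cls L n z) = cls K n (pullback K n f z)"
proof (intro equalityI subsetI)
  fix x assume "x \<in> induced K n f (cls L n z)"
  then obtain c e where *: "x = (\<lambda>vs. pullback K n f c vs + e vs)"
    "c \<in> cls L n z" "e \<in> coboundaries K n"
    by (auto simp: induced_def)
  then have "pullback K n f (\<lambda>vs. c vs - z vs) \<in> coboundaries K n"
    by (intro pullback_coboundaries[OF assms]) (simp add: mem_cls_iff)
  then show "x \<in> cls K n (pullback K n f z)"
    using coboundaries_add[OF _ *(3), of "pullback K n f (\<lambda>vs. c vs - z vs)"]
      pullback_lincomb[of K n f 1 c "-1" z]
    by (simp add: *(1) mem_cls_iff diff_add_eq)
next
  fix x assume "x \<in> cls K n (pullback K n f z)"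
  then show "x \<in> induced K n f (cls L n z)"
    unfolding induced_def using zero_coboundaries[of L n]
    by (intro CollectI exI[of _ z] exI[of _ "\<lambda>vs. x vs - pullback K n f z vs"])
      (simp add: mem_cls_iff)
qed

section \<open>The Leibniz rule and the cup product in positive degrees\<close>

lemma take_drop_ordered_simplices:
  assumes "simplicial_complex K" "vs \<in> ordered_simplices K (int p + int q)"
  shows "take (Suc p) vs \<in> ordered_simplices K (int p)"
    and "drop p vs \<in> ordered_simplices K (int q)"
proof -
  have "length vs = Suc (p + q)" using assms(2) by (simp add: ordered_simplices_def)
  then show "take (Suc p) vs \<in> ordered_simplices K (int p)"
    and "drop p vs \<in> ordered_simplices K (int q)"
    by (auto intro!: ordered_simplices_mono[OF assms] dest: in_set_takeD in_set_dropD)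
qed

lemma cochain_cup_int:
  "cochain_cup K (int p) (int q) c d = (\<lambda>vs. if vs \<in> ordered_simplices K (int p + int q)
     then c (take (Suc p) vs) * d (drop p vs) else 0)"
  by (simp add: cochain_cup_def nat_add_distrib fun_eq_iff)

text \<open>Degrees are natural numbers because the rule breaks down in degree -1: a product of
  cochains with such a factor is 0, but the coboundary of that factor is a constant 0-cochain, and
  multiplying by it scales the other factor.\<close>

lemma coboundary_cup:
  assumes "simplicial_complex K"
  shows "coboundary K (int p + int q) (cochain_cup K (int p) (int q) c d) =
    (\<lambda>vs. cochain_cup K (int (Suc p)) (int q) (coboundary K (int p) c) d vs +
      (- 1) ^ p * cochain_cup K (int p) (int (Suc q)) c (coboundary K (int q) d) vs)"
proof
  fix vs
  show "coboundary K (int p + int q) (cochain_cup K (int p) (int q) c d) vs =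
    cochain_cup K (int (Suc p)) (int q) (coboundary K (int p) c) d vs +
      (- 1) ^ p * cochain_cup K (int p) (int (Suc q)) c (coboundary K (int q) d) vs"
  proof (cases "vs \<in> ordered_simplices K (int p + int q + 1)")
    case True
    then have 1: "vs \<in> ordered_simplices K (int (Suc p) + int q)"
      and 2: "vs \<in> ordered_simplices K (int p + int (Suc q))"
      by (simp_all add: algebra_simps)
    have l: "p + 2 \<le> length vs" using True by (auto simp: ordered_simplices_def)
    have "alt_sum (cochain_cup K (int p) (int q) c d) vs =
        alt_sum (\<lambda>us. c (take (Suc p) us) * d (drop p us)) vs"
      by (intro alt_sum_cong)
        (use face_ordered_simplices[OF assms True] in \<open>simp add: cochain_cup_int\<close>)
    also note alt_sum_cup[OF l]
    finally have lhs: "coboundary K (int p + int q) (cochain_cup K (int p) (int q) c d) vs =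
        alt_sum c (take (p + 2) vs) * d (drop (Suc p) vs) +
        (- 1) ^ p * (c (take (Suc p) vs) * alt_sum d (drop p vs))"
      using True by (simp add: coboundary_eq)
    have "take (p + 2) vs \<in> ordered_simplices K (int p + 1)"
      using take_drop_ordered_simplices(1)[OF assms 1] by (simp add: add.commute)
    then have rhs1: "cochain_cup K (int (Suc p)) (int q) (coboundary K (int p) c) d vs =
        alt_sum c (take (p + 2) vs) * d (drop (Suc p) vs)"
      unfolding cochain_cup_int using 1 by (simp add: coboundary_eq)
    have "drop p vs \<in> ordered_simplices K (int q + 1)"
      using take_drop_ordered_simplices(2)[OF assms 2] by (simp add: add.commute)
    then have rhs2: "cochain_cup K (int p) (int (Suc q)) c (coboundary K (int q) d) vs =
        c (take (Suc p) vs) * alt_sum d (drop p vs)"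
      unfolding cochain_cup_int using 2 by (simp add: coboundary_eq)
    show ?thesis unfolding lhs rhs1 rhs2 ..
  next
    case False
    then have "vs \<notin> ordered_simplices K (int (Suc p) + int q)"
      "vs \<notin> ordered_simplices K (int p + int (Suc q))"
      by (simp_all add: algebra_simps)
    with False show ?thesis by (simp add: cochain_cup_def coboundary_eq del: of_nat_Suc)
  qed
qed

lemma cochain_cup_cochains: "cochain_cup K p q c d \<in> cochains K (p + q)"
  by (simp add: cochain_cup_def cochains_def)

lemma cochain_cup_lincomb_left:
  "cochain_cup K p q (\<lambda>vs. s * c vs + t * c' vs) d =
    (\<lambda>vs. s * cochain_cup K p q c d vs + t * cochain_cup K p q c' d vs)"
  by (simp add: cochain_cup_def fun_eq_iff algebra_simps)

lemma cochain_cup_lincomb_right: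
  "cochain_cup K p q c (\<lambda>vs. s * d vs + t * d' vs) =
    (\<lambda>vs. s * cochain_cup K p q c d vs + t * cochain_cup K p q c d' vs)"
  by (simp add: cochain_cup_def fun_eq_iff algebra_simps)

lemma cochain_cup_zero: "cochain_cup K p q (\<lambda>_. 0) d = (\<lambda>_. 0)"
  "cochain_cup K p q c (\<lambda>_. 0) = (\<lambda>_. 0)"
  by (simp_all add: cochain_cup_def fun_eq_iff)

lemma cocyclesD: "c \<in> cocycles K n \<Longrightarrow> coboundary K n c = (\<lambda>_. 0)"
  by (simp add: cocycles_def)

lemma cup_cocycles:
  assumes "simplicial_complex K" "p \<ge> 1" "q \<ge> 1" "c \<in> cocycles K p" "d \<in> cocycles K q"
  shows "cochain_cup K p q c d \<in> cocycles K (p + q)"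
proof -
  obtain P Q where p: "p = int P" and q: "q = int Q"
    using that[of "nat p" "nat q"] assms(2,3) by simp
  show ?thesis
    using coboundary_cup[OF assms(1), of P Q c d] assms(4,5)
    by (simp add: cocycles_def cochain_cup_cochains p q cochain_cup_zero)
qed

text \<open>A primitive \<open>e\<close> of \<open>c\<close> has degree p - 1, which is nonnegative,
  so the Leibniz rule applies to the product of \<open>e\<close> and \<open>d\<close>; its second
  term dies because \<open>d\<close> is a cocycle.\<close>

lemma cup_coboundary_left:
  assumes "simplicial_complex K" "p \<ge> 1" "q \<ge> 1" "c \<in> coboundaries K p" "d \<in> cocycles K q"
  shows "cochain_cup K p q c d \<in> coboundaries K (p + q)"
proof -
  obtain P Q where p: "p = int (Suc P)" and q: "q = int Q"
    using that[of "nat (p - 1)" "nat q"] assms(2,3) by simp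
  obtain e where c: "c = coboundary K (int P) e" using assms(4) by (auto simp: coboundaries_def p)
  have "coboundary K (int P + int Q) (cochain_cup K (int P) (int Q) e d) = cochain_cup K p q c d"
    using coboundary_cup[OF assms(1), of P Q e d] cocyclesD[OF assms(5)]
    by (simp add: p q c cochain_cup_zero)
  moreover have "p + q - 1 = int P + int Q" by (simp add: p q)
  ultimately show ?thesis
    by (auto simp: coboundaries_def intro: image_eqI[OF sym cochain_cup_cochains])
qed

lemma cup_coboundary_right:
  assumes "simplicial_complex K" "p \<ge> 1" "q \<ge> 1" "c \<in> cocycles K p" "d \<in> coboundaries K q"
  shows "cochain_cup K p q c d \<in> coboundaries K (p + q)"
proof -
  obtain P Q where p: "p = int P" and q: "q = int (Suc Q)"
    using that[of "nat p" "nat (q - 1)"] assms(2,3) by simp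
  obtain e where d: "d = coboundary K (int Q) e" using assms(5) by (auto simp: coboundaries_def q)
  have "coboundary K (int P + int Q) (cochain_cup K (int P) (int Q) c e) =
      (\<lambda>vs. (- 1) ^ P * cochain_cup K p q c d vs)"
    using coboundary_cup[OF assms(1), of P Q c e] cocyclesD[OF assms(4)]
    by (simp add: p q d cochain_cup_zero)
  moreover have "p + q - 1 = int P + int Q" by (simp add: p q)
  ultimately have "(\<lambda>vs. (- 1) ^ P * cochain_cup K p q c d vs) \<in> coboundaries K (p + q)"
    by (auto simp: coboundaries_def intro: image_eqI[OF sym cochain_cup_cochains])
  \<comment> \<open>Leibniz gives the product only up to the sign (-1)^P; multiplying by the same
    sign once more removes it.\<close>
  from coboundaries_scale[OF this, of "(- 1) ^ P"] show ?thesis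
    by (simp add: mult.assoc[symmetric] power_add[symmetric] mult_2[symmetric])
qed

text \<open>In positive degrees the products of representatives fill exactly one coset, so the
  default value in \<open>class_cup\<close> is not taken.\<close>

lemma class_cup_cls:
  assumes K: "simplicial_complex K" and pq: "p \<ge> 1" "q \<ge> 1"
    and z: "z \<in> cocycles K p" and w: "w \<in> cocycles K q"
  shows "class_cup K p q (cls K p z) (cls K q w) = cls K (p + q) (cochain_cup K p q z w)"
proof -
  let ?Z = "{\<lambda>vs. cochain_cup K p q c d vs + e vs | c d e.
    c \<in> cls K p z \<and> d \<in> cls K q w \<and> e \<in> coboundaries K (p + q)}"
  have "?Z = cls K (p + q) (cochain_cup K p q z w)"
  proof (intro equalityI subsetI)
    fix x assume "x \<in> ?Z"
    then obtain c d e where x: "x = (\<lambda>vs. cochain_cup K p q c d vs + e vs)"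
      and c: "(\<lambda>vs. c vs - z vs) \<in> coboundaries K p"
      and d: "(\<lambda>vs. d vs - w vs) \<in> coboundaries K q" and e: "e \<in> coboundaries K (p + q)"
      by (auto simp: mem_cls_iff)
    \<comment> \<open>The difference of the products of c, d and of z, w is (c - z) d + z (d - w);
      its first term is a coboundary only if \<open>d\<close> is a cocycle.\<close>
    have d': "d \<in> cocycles K q"
      using cocycles_add[OF coboundaries_subset_cocycles[OF K d] w] by simp
    have "(\<lambda>vs. cochain_cup K p q (\<lambda>vs. c vs - z vs) d vs +
        cochain_cup K p q z (\<lambda>vs. d vs - w vs) vs) \<in> coboundaries K (p + q)"
      by (intro coboundaries_add cup_coboundary_left cup_coboundary_right assms c d d')
    from coboundaries_add[OF this e] show "x \<in> cls K (p + q) (cochain_cup K p q z w)"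
      using cochain_cup_lincomb_left[of K p q 1 c "-1" z d]
        cochain_cup_lincomb_right[of K p q z 1 d "-1" w]
      by (simp add: x mem_cls_iff diff_add_eq)
  next
    fix x assume "x \<in> cls K (p + q) (cochain_cup K p q z w)"
    then show "x \<in> ?Z" using zero_coboundaries[of K p] zero_coboundaries[of K q]
      by (intro CollectI exI[of _ z] exI[of _ w]
          exI[of _ "\<lambda>vs. x vs - cochain_cup K p q z w vs"]) (simp add: mem_cls_iff)
  qed
  then show ?thesis
    by (simp add: class_cup_def cls_in_cohomology cup_cocycles[OF assms])
qed

section \<open>The cup product when a degree is not positive\<close>

lemma cls_zero_mem:
  assumes "X \<in> cohomology K n" "(\<lambda>_. 0) \<in> X"
  shows "X = coboundaries K n"
proof -
  obtain z where z: "X = cls K n z" using assms(1) by (rule cohomologyE)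
  have "(\<lambda>vs. 0 - z vs) \<in> coboundaries K n" using assms(2) by (simp only: z mem_cls_iff)
  from cls_eqI[OF this] show ?thesis by (simp only: z coboundaries_eq_cls)
qed

lemma cohomology_diff:
  assumes "X \<in> cohomology K n" "x \<in> X" "y \<in> X"
  shows "(\<lambda>vs. x vs - y vs) \<in> coboundaries K n"
proof -
  obtain z where "X = cls K n z" using assms(1) by (rule cohomologyE)
  then show ?thesis
    using assms(2,3) coboundaries_diff[of "\<lambda>vs. x vs - z vs" K n "\<lambda>vs. y vs - z vs"]
    by (simp add: mem_cls_iff)
qed

text \<open>The effect of the augmentation: the empty list spans degree -1, and the coboundary of
  its indicator is the constant 1.\<close>

lemma constant_coboundary:
  "(\<lambda>vs. if vs \<in> ordered_simplices K 0 then 1 else 0) \<in> coboundaries K 0"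
  unfolding coboundaries_def
proof (rule image_eqI)
  show "(\<lambda>vs. if vs = [] then 1 else 0) \<in> cochains K (0 - 1)"
    by (simp add: cochains_def ordered_simplices_def)
  show "(\<lambda>vs. if vs \<in> ordered_simplices K 0 then 1 else 0) =
      coboundary K (0 - 1) (\<lambda>vs. if vs = [] then 1 else 0)"
    by (auto simp: fun_eq_iff coboundary_def ordered_simplices_def face_def length_Suc_conv)
qed

text \<open>If the products of representatives form a class, that class contains 0. In degree 0 this is
  because adding the constant 1, a coboundary, to one factor changes the product by the other
  factor, which is then itself a coboundary.\<close>

lemma class_cup_trivial:
  assumes K: "simplicial_complex K" and pq: "\<not> (p \<ge> 1 \<and> q \<ge> 1)"
    and X: "X \<in> cohomology K p" and Y: "Y \<in> cohomology K q"
  shows "class_cup K p q X Y = coboundaries K (p + q)"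
proof -
  let ?Z = "{\<lambda>vs. cochain_cup K p q c d vs + e vs | c d e.
    c \<in> X \<and> d \<in> Y \<and> e \<in> coboundaries K (p + q)}"
  obtain z where z: "z \<in> cocycles K p" "X = cls K p z" using X by (rule cohomologyE)
  obtain w where w: "w \<in> cocycles K q" "Y = cls K q w" using Y by (rule cohomologyE)
  have mem: "z \<in> X" "w \<in> Y" by (simp_all add: z w mem_cls_iff zero_coboundaries)
  have Z: "cochain_cup K p q c d \<in> ?Z" if "c \<in> X" "d \<in> Y" for c d
    using zero_coboundaries[of K "p + q"] that
    by (intro CollectI exI[of _ c] exI[of _ d] exI[of _ "\<lambda>_. 0"]) simp
  have "(\<lambda>_. 0) \<in> ?Z" if Zc: "?Z \<in> cohomology K (p + q)"
  proof -
    consider "p < 0 \<or> q < 0" | "p = 0" "q \<ge> 0" | "p \<ge> 0" "q = 0" using pq by linarith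
    then show ?thesis
    proof cases
      case 1
      have "z (take (nat (p + 1)) vs) * w (drop (nat p) vs) = 0"
        if vs: "vs \<in> ordered_simplices K (p + q)" for vs
      proof -
        \<comment> \<open>The lengths do not fit. For p = -1 the list has q entries and the back
          part keeps all of them, one too few for degree q; q = -1 is symmetric. Below degree -1
          there are no simplices.\<close>
        have "take (nat (p + 1)) vs \<notin> ordered_simplices K p \<or>
            drop (nat p) vs \<notin> ordered_simplices K q"
          using vs 1 by (auto simp: ordered_simplices_def)
        then show ?thesis using z(1) w(1) by (auto simp: cocycles_def cochains_def)
      qed
      then have "cochain_cup K p q z w = (\<lambda>_. 0)" by (auto simp: cochain_cup_def)
      then show ?thesis using Z[OF mem] by simp
    next
      case 2
      let ?u = "\<lambda>vs. if vs \<in> ordered_simplices K 0 then 1 else 0"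
      have "(\<lambda>vs. z vs + ?u vs) \<in> X"
        using constant_coboundary[of K] 2 by (simp add: z mem_cls_iff)
      from cohomology_diff[OF Zc Z[OF this mem(2)] Z[OF mem]]
      have "cochain_cup K p q ?u w \<in> coboundaries K (p + q)"
        using cochain_cup_lincomb_left[of K p q 1 z 1 ?u w] by simp
      moreover have "cochain_cup K p q ?u w = w"
      proof
        fix vs
        obtain Q where q: "q = int Q" using that[of "nat q"] 2 by simp
        show "cochain_cup K p q ?u w vs = w vs"
          using take_drop_ordered_simplices(1)[OF K, of vs 0 Q] w(1) 2
          by (auto simp: cochain_cup_def cocycles_def cochains_def q)
      qed
      \<comment> \<open>Now 0 represents \<open>Y\<close>, and multiplying \<open>z\<close> by it
        exhibits 0 among the products.\<close>
      ultimately have "Y = coboundaries K q"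
        using 2 by (simp add: w(2) coboundaries_eq_cls cls_eqI)
      then show ?thesis
        using Z[OF mem(1), of "\<lambda>_. 0"] zero_coboundaries[of K q] by (simp add: cochain_cup_zero)
    next
      case 3
      let ?u = "\<lambda>vs. if vs \<in> ordered_simplices K 0 then 1 else 0"
      have "(\<lambda>vs. w vs + ?u vs) \<in> Y"
        using constant_coboundary[of K] 3 by (simp add: w mem_cls_iff)
      from cohomology_diff[OF Zc Z[OF mem(1) this] Z[OF mem]]
      have "cochain_cup K p q z ?u \<in> coboundaries K (p + q)"
        using cochain_cup_lincomb_right[of K p q z 1 w 1 ?u] by simp
      moreover have "cochain_cup K p q z ?u = z"
      proof
        fix vs
        obtain P where p: "p = int P" using that[of "nat p"] 3 by simp
        show "cochain_cup K p q z ?u vs = z vs"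
          using take_drop_ordered_simplices(2)[OF K, of vs P 0] z(1) 3
          by (auto simp: cochain_cup_def cocycles_def cochains_def p ordered_simplices_def
              nat_add_distrib)
      qed
      ultimately have "X = coboundaries K p"
        using 3 by (simp add: z(2) coboundaries_eq_cls cls_eqI)
      then show ?thesis
        using Z[OF _ mem(2), of "\<lambda>_. 0"] zero_coboundaries[of K p] by (simp add: cochain_cup_zero)
    qed
  qed
  then show ?thesis
    using cls_zero_mem[of ?Z K "p + q"] by (auto simp: class_cup_def Let_def)
qed

section \<open>Vector space structure and functoriality of cohomology\<close>

lemma class_add_closed:
  "X \<in> cohomology K n \<Longrightarrow> Y \<in> cohomology K n \<Longrightarrow> class_add X Y \<in> cohomology K n"
  by (elim cohomologyE) (simp add: class_add_cls cls_in_cohomology cocycles_add)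

lemma class_add_assoc:
  "X \<in> cohomology K n \<Longrightarrow> Y \<in> cohomology K n \<Longrightarrow> Z \<in> cohomology K n \<Longrightarrow>
    class_add (class_add X Y) Z = class_add X (class_add Y Z)"
  by (elim cohomologyE) (simp add: class_add_cls add.assoc)

lemma class_add_commute:
  "X \<in> cohomology K n \<Longrightarrow> Y \<in> cohomology K n \<Longrightarrow> class_add X Y = class_add Y X"
  by (elim cohomologyE) (simp add: class_add_cls add.commute)

lemma class_add_zero:
  "X \<in> cohomology K n \<Longrightarrow> class_add (coboundaries K n) X = X"
  by (elim cohomologyE) (simp add: class_add_cls coboundaries_eq_cls)

lemma class_add_zero_right: "X \<in> cohomology K n \<Longrightarrow> class_add X (coboundaries K n) = X"
  by (metis class_add_commute class_add_zero coboundaries_in_cohomology)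

lemma class_scale_closed:
  "X \<in> cohomology K n \<Longrightarrow> class_scale K n t X \<in> cohomology K n"
  by (elim cohomologyE) (simp add: class_scale_cls cls_in_cohomology cocycles_scale)

lemma class_add_minus:
  "X \<in> cohomology K n \<Longrightarrow> class_add (class_scale K n (- 1) X) X = coboundaries K n"
  by (elim cohomologyE) (simp add: class_scale_cls class_add_cls coboundaries_eq_cls)

lemma class_scale_add:
  "X \<in> cohomology K n \<Longrightarrow> Y \<in> cohomology K n \<Longrightarrow>
    class_scale K n t (class_add X Y) = class_add (class_scale K n t X) (class_scale K n t Y)"
  by (elim cohomologyE) (simp add: class_scale_cls class_add_cls distrib_left)

lemma class_scale_add_scalar:
  "X \<in> cohomology K n \<Longrightarrow>
    class_scale K n (t + u) X = class_add (class_scale K n t X) (class_scale K n u X)"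
  by (elim cohomologyE) (simp add: class_scale_cls class_add_cls distrib_right)

lemma class_scale_scale:
  "X \<in> cohomology K n \<Longrightarrow> class_scale K n t (class_scale K n u X) = class_scale K n (t * u) X"
  by (elim cohomologyE) (simp add: class_scale_cls mult.assoc)

lemma class_scale_one: "X \<in> cohomology K n \<Longrightarrow> class_scale K n 1 X = X"
  by (elim cohomologyE) (simp add: class_scale_cls)

lemma class_scale_zero_scalar: "X \<in> cohomology K n \<Longrightarrow> class_scale K n 0 X = coboundaries K n"
  by (elim cohomologyE) (simp add: class_scale_cls coboundaries_eq_cls)

lemma class_scale_zero: "class_scale K n t (coboundaries K n) = coboundaries K n"
  by (simp add: class_scale_cls coboundaries_eq_cls)

context
  fixes K L :: "'v set set" and f :: "'v \<Rightarrow> 'v"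
  assumes K: "simplicial_complex K" and f: "simplicial_map K L f"
begin

lemma induced_closed: "X \<in> cohomology L n \<Longrightarrow> induced K n f X \<in> cohomology K n"
  by (elim cohomologyE) (simp add: induced_cls[OF K f] cls_in_cohomology pullback_cocycles[OF K f])

lemma induced_add:
  "X \<in> cohomology L n \<Longrightarrow> Y \<in> cohomology L n \<Longrightarrow>
    induced K n f (class_add X Y) = class_add (induced K n f X) (induced K n f Y)"
  by (elim cohomologyE)
    (simp add: pullback_lincomb[where s = 1 and t = 1, simplified] induced_cls[OF K f]
      class_add_cls)

lemma induced_scale:
  "X \<in> cohomology L n \<Longrightarrow>
    induced K n f (class_scale L n t X) = class_scale K n t (induced K n f X)"
  by (elim cohomologyE)
    (simp add: pullback_lincomb[where t = 0, simplified] induced_cls[OF K f] class_scale_cls)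

lemma induced_zero: "induced K n f (coboundaries L n) = coboundaries K n"
  unfolding coboundaries_eq_cls induced_cls[OF K f] by (simp add: pullback_def)

text \<open>Vertex maps are meaningful only on vertices of \<open>K\<close>, so they are compared
  there. The entries of ordered simplices are such vertices, and the pulled back cochains agree
  exactly.\<close>

lemma induced_comp:
  assumes L: "simplicial_complex L" and g: "simplicial_map L M g" and h: "simplicial_map K M h"
    and eq: "\<And>v. v \<in> \<Union>K \<Longrightarrow> h v = g (f v)" and X: "X \<in> cohomology M n"
  shows "induced K n f (induced L n g X) = induced K n h X"
proof -
  obtain z where z: "X = cls M n z" using X by (rule cohomologyE)
  have "map h vs = map g (map f vs)" if "vs \<in> ordered_simplices K n" for vs
    using that eq by (auto simp: ordered_simplices_def)
  then have "pullback K n f (pullback L n g z) = pullback K n h z"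
    by (auto simp: pullback_def fun_eq_iff map_ordered_simplices[OF f] simp del: map_map)
  then show ?thesis
    by (simp add: z induced_cls[OF L g] induced_cls[OF K f] induced_cls[OF K h])
qed

end

lemma induced_id:
  assumes K: "simplicial_complex K" and f: "\<And>v. v \<in> \<Union>K \<Longrightarrow> f v = v" and X: "X \<in> cohomology K n"
  shows "induced K n f X = X"
proof -
  obtain z where z: "z \<in> cocycles K n" "X = cls K n z" using X by (rule cohomologyE)
  have "f ` \<sigma> = \<sigma>" if "\<sigma> \<in> K" for \<sigma> using f that by force
  then have m: "simplicial_map K K f" by (simp add: simplicial_map_def)
  have "map f vs = vs" if "vs \<in> ordered_simplices K n" for vs
    using that f by (intro map_idI) (auto simp: ordered_simplices_def)
  \<comment> \<open>Off the ordered simplices both sides vanish, \<open>z\<close> being a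
    cochain.\<close>
  then have "pullback K n f z = z"
    using z(1) by (auto simp: pullback_def fun_eq_iff cocycles_def cochains_def)
  then show ?thesis by (simp add: z induced_cls[OF K m])
qed

section \<open>Laws of the cup product on a single complex\<close>

context
  fixes K :: "'v set set"
  assumes K: "simplicial_complex K"
begin

text \<open>As in the laws that follow, positive degrees are treated on representatives, and
  otherwise \<open>class_cup_trivial\<close> makes the product the zero class.\<close>

lemma class_cup_closed:
  assumes "X \<in> cohomology K p" "Y \<in> cohomology K q"
  shows "class_cup K p q X Y \<in> cohomology K (p + q)"
proof (cases "p \<ge> 1 \<and> q \<ge> 1")
  case True
  with assms show ?thesis
    by (elim cohomologyE) (simp add: class_cup_cls[OF K] cls_in_cohomology cup_cocycles[OF K])
qed (simp add: assms class_cup_trivial[OF K] coboundaries_in_cohomology)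

lemma class_cup_add_left:
  assumes "X \<in> cohomology K p" "X' \<in> cohomology K p" "Y \<in> cohomology K q"
  shows "class_cup K p q (class_add X X') Y =
    class_add (class_cup K p q X Y) (class_cup K p q X' Y)"
proof (cases "p \<ge> 1 \<and> q \<ge> 1")
  case True
  then show ?thesis using assms
    by (elim cohomologyE) (simp add: cochain_cup_lincomb_left[where s = 1 and t = 1, simplified]
        class_add_cls class_cup_cls[OF K] cocycles_add)
qed (simp_all add: assms class_cup_trivial[OF K] class_add_closed class_add_zero
    coboundaries_in_cohomology)

lemma class_cup_add_right:
  assumes "X \<in> cohomology K p" "Y \<in> cohomology K q" "Y' \<in> cohomology K q"
  shows "class_cup K p q X (class_add Y Y') =
    class_add (class_cup K p q X Y) (class_cup K p q X Y')"
proof (cases "p \<ge> 1 \<and> q \<ge> 1")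
  case True
  then show ?thesis using assms
    by (elim cohomologyE) (simp add: cochain_cup_lincomb_right[where s = 1 and t = 1, simplified]
        class_add_cls class_cup_cls[OF K] cocycles_add)
qed (simp_all add: assms class_cup_trivial[OF K] class_add_closed class_add_zero
    coboundaries_in_cohomology)

lemma class_cup_scale:
  assumes "X \<in> cohomology K p" "Y \<in> cohomology K q"
  shows "class_cup K p q (class_scale K p t X) (class_scale K q u Y) =
    class_scale K (p + q) (t * u) (class_cup K p q X Y)"
proof (cases "p \<ge> 1 \<and> q \<ge> 1")
  case True
  have "cochain_cup K p q (\<lambda>vs. t * z vs) (\<lambda>vs. u * w vs) =
      (\<lambda>vs. t * u * cochain_cup K p q z w vs)" for z w
    by (simp add: cochain_cup_def fun_eq_iff)
  then show ?thesis using assms True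
    by (elim cohomologyE) (simp add: class_scale_cls class_cup_cls[OF K] cocycles_scale)
qed (simp_all add: assms class_cup_trivial[OF K] class_scale_closed class_scale_zero)

text \<open>The zero class is 0 times itself, so compatibility with scalars covers all degrees at
  once.\<close>

lemma class_cup_zero_left:
  assumes "Y \<in> cohomology K q"
  shows "class_cup K p q (coboundaries K p) Y = coboundaries K (p + q)"
  using class_cup_scale[OF coboundaries_in_cohomology[of K p] assms, of 0 1]
  by (simp add: class_scale_zero class_scale_one assms class_scale_zero_scalar class_cup_closed
      coboundaries_in_cohomology)

lemma class_cup_zero_right:
  assumes "X \<in> cohomology K p"
  shows "class_cup K p q X (coboundaries K q) = coboundaries K (p + q)"
  using class_cup_scale[OF assms coboundaries_in_cohomology[of K q], of 1 0]
  by (simp add: class_scale_zero class_scale_one assms class_scale_zero_scalar class_cup_closed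
      coboundaries_in_cohomology)

lemma class_cup_assoc:
  assumes X: "X \<in> cohomology K p" and Y: "Y \<in> cohomology K q" and Z: "Z \<in> cohomology K r"
  shows "class_cup K (p + q) r (class_cup K p q X Y) Z =
    class_cup K p (q + r) X (class_cup K q r Y Z)"
proof (cases "p \<ge> 1 \<and> q \<ge> 1 \<and> r \<ge> 1")
  case True
  obtain x where x: "x \<in> cocycles K p" "X = cls K p x" using X by (rule cohomologyE)
  obtain y where y: "y \<in> cocycles K q" "Y = cls K q y" using Y by (rule cohomologyE)
  obtain z where z: "z \<in> cocycles K r" "Z = cls K r z" using Z by (rule cohomologyE)
  obtain P Q R where pqr: "p = int P" "q = int Q" "r = int R"
    using that[of "nat p" "nat q" "nat r"] True by simp
  have "cochain_cup K (p + q) r (cochain_cup K p q x y) z =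
      cochain_cup K p (q + r) x (cochain_cup K q r y z)"
  proof
    fix vs
    show "cochain_cup K (p + q) r (cochain_cup K p q x y) z vs =
        cochain_cup K p (q + r) x (cochain_cup K q r y z) vs"
    proof (cases "vs \<in> ordered_simplices K (int (P + Q) + int R)")
      case True
      then have vs: "vs \<in> ordered_simplices K (int P + int (Q + R))" by (simp add: add.assoc)
      \<comment> \<open>Both bracketings evaluate x, y, z on the entries 0 to P, P to P + Q and P +
        Q to P + Q + R. Membership of these parts ensures that the inner products are not cut
        off.\<close>
      have "take (Suc (P + Q)) vs \<in> ordered_simplices K (int P + int Q)"
        "drop P vs \<in> ordered_simplices K (int Q + int R)"
        using take_drop_ordered_simplices(1)[OF K True] take_drop_ordered_simplices(2)[OF K vs]
        by simp_all
      moreover have "drop P (take (Suc (P + Q)) vs) = take (Suc Q) (drop P vs)"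
        by (simp add: drop_take)
      moreover have "drop (P + Q) vs = drop Q (drop P vs)" by (simp add: add.commute)
      ultimately show ?thesis
        using True vs unfolding pqr of_nat_add[symmetric] cochain_cup_int
        by (simp only: of_nat_add[symmetric] if_True take_take mult.assoc) simp
    next
      case False
      then show ?thesis by (simp add: cochain_cup_def pqr add.assoc)
    qed
  qed
  then show ?thesis
    using True x y z by (simp add: class_cup_cls[OF K] cup_cocycles[OF K] add.assoc)
next
  case False
  \<comment> \<open>An inner product can have positive degree although one of its factors does not,
    so the outer product need not be trivial. Each side vanishes through its inner or its outer
    product, depending on which of q, p, r fails to be positive.\<close>
  consider "\<not> (p \<ge> 1 \<and> q \<ge> 1)" "\<not> (q \<ge> 1 \<and> r \<ge> 1)" | "\<not> (p \<ge> 1 \<and> q \<ge> 1)" "\<not> p \<ge> 1"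
    | "\<not> r \<ge> 1" "\<not> (q \<ge> 1 \<and> r \<ge> 1)"
    using False by blast
  then show ?thesis
    by cases (simp_all add: assms class_cup_trivial[OF K] class_cup_zero_left class_cup_zero_right
        class_cup_closed coboundaries_in_cohomology add.assoc)
qed

text \<open>Front and back parts commute with \<open>map f\<close>, so pullback is multiplicative on
  cochains. Outside positive degrees the default is natural because induced maps preserve the zero
  class.\<close>

lemma induced_class_cup:
  assumes L: "simplicial_complex L" and f: "simplicial_map K L f"
    and X: "X \<in> cohomology L p" and Y: "Y \<in> cohomology L q"
  shows "induced K (p + q) f (class_cup L p q X Y) =
    class_cup K p q (induced K p f X) (induced K q f Y)"
proof (cases "p \<ge> 1 \<and> q \<ge> 1")
  case True
  obtain x where x: "x \<in> cocycles L p" "X = cls L p x" using X by (rule cohomologyE)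
  obtain y where y: "y \<in> cocycles L q" "Y = cls L q y" using Y by (rule cohomologyE)
  obtain P Q where pq: "p = int P" "q = int Q"
    using that[of "nat p" "nat q"] True by simp
  have "pullback K (p + q) f (cochain_cup L p q x y) =
      cochain_cup K p q (pullback K p f x) (pullback K q f y)"
    using take_drop_ordered_simplices[OF K, of _ P Q] map_ordered_simplices[OF f]
    by (auto simp: fun_eq_iff pullback_def pq cochain_cup_int take_map drop_map)
  then show ?thesis
    using True x y
    by (simp add: class_cup_cls[OF K] class_cup_cls[OF L] cup_cocycles[OF L]
        induced_cls[OF K f] pullback_cocycles[OF K f])
qed (simp_all add: assms class_cup_trivial[OF K] class_cup_trivial[OF L] induced_zero[OF K f]
    induced_closed[OF K f])

end

lemma poly_mapping_eq_sum_single: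
  "r = (\<Sum>x \<in> Poly_Mapping.keys r. Poly_Mapping.single x (Poly_Mapping.lookup r x))"
  by (rule poly_mapping_eqI) (simp add: lookup_sum lookup_single when_def in_keys_iff)

text \<open>Scalars of the monoid ring sit at exponent 0, so convolution with them shifts nothing.
  This serves the bilinearity of the twisting functions.\<close>

lemma lookup_single_zero_times:
  "Poly_Mapping.lookup (Poly_Mapping.single (0::'a::comm_monoid_add) (t::'b::comm_semiring_0)
      * r) x =
    t * Poly_Mapping.lookup r x"
proof -
  have "Poly_Mapping.single 0 t * r =
      (\<Sum>x \<in> Poly_Mapping.keys r. Poly_Mapping.single x (t * Poly_Mapping.lookup r x))"
    by (subst (1) poly_mapping_eq_sum_single[of r]) (simp add: sum_distrib_left mult_single)
  then show ?thesis by (simp add: lookup_sum lookup_single when_def in_keys_iff)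
qed

section \<open>The graded module and the persistence-cup product\<close>

text \<open>The parameter \<open>field_type\<close> only fixes the coefficient field.\<close>

locale cayley_persistence =
  fixes S :: "'g::ab_group_add set" and K :: "'g \<Rightarrow> 'v set set" and \<phi> :: "'g \<Rightarrow> 'g \<Rightarrow> 'v \<Rightarrow> 'v"
    and field_type :: "'k::field itself"
  assumes zero_in_S: "0 \<in> S"
    and add_in_S: "\<And>x y. x \<in> S \<Longrightarrow> y \<in> S \<Longrightarrow> x + y \<in> S"
    and S_pointed: "\<And>x. x \<in> S \<Longrightarrow> - x \<in> S \<Longrightarrow> x = 0"
    and products: "\<And>b c. \<exists>m. is_cay_product S b c m"
    and complex: "cayley_persistence_complex S K \<phi>"
begin

abbreviation coh :: "'g \<Rightarrow> int \<Rightarrow> ('v list \<Rightarrow> 'k) set set" where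
  "coh a n \<equiv> cohomology (K a) n"

abbreviation zero_class :: "'g \<Rightarrow> int \<Rightarrow> ('v list \<Rightarrow> 'k) set" where
  "zero_class a n \<equiv> coboundaries (K a) n"

abbreviation res :: "int \<Rightarrow> 'g \<Rightarrow> 'g \<Rightarrow> ('v list \<Rightarrow> 'k) set \<Rightarrow> ('v list \<Rightarrow> 'k) set" where
  "res n a b \<equiv> induced (K a) n (\<phi> a b)"

abbreviation meet :: "'g \<Rightarrow> 'g \<Rightarrow> 'g" where
  "meet \<equiv> cay_product S"

abbreviation G :: "('g, 'v, 'k) coh ring" where
  "G \<equiv> coh_group K"

abbreviation inj :: "'g \<Rightarrow> int \<Rightarrow> ('v list \<Rightarrow> 'k) set \<Rightarrow> ('g, 'v, 'k) coh" where
  "inj \<equiv> coh_inject K"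

abbreviation act :: "('g \<Rightarrow>\<^sub>0 'k) \<Rightarrow> ('g, 'v, 'k) coh \<Rightarrow> ('g, 'v, 'k) coh" where
  "act \<equiv> coh_action K \<phi>"

abbreviation cup :: "('g, 'v, 'k) coh \<Rightarrow> ('g, 'v, 'k) coh \<Rightarrow> ('g, 'v, 'k) coh" where
  "cup \<equiv> persistence_cup S K \<phi>"

abbreviation H :: "('g \<Rightarrow>\<^sub>0 'k, ('g, 'v, 'k) coh) module" where
  "H \<equiv> persistence_cohomology S K \<phi>"

abbreviation R :: "('g \<Rightarrow>\<^sub>0 'k) ring" where
  "R \<equiv> persistence_ring S"

section \<open>The poset and its meets\<close>

lemma cay_le_trans: "cay_le S a b \<Longrightarrow> cay_le S b c \<Longrightarrow> cay_le S a c"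
  using add_in_S[of "b - a" "c - b"] by (simp add: cay_le_def)

text \<open>The only use of \<open>S_pointed\<close>: it turns the preorder into an order and so
  makes meets unique.\<close>

lemma cay_le_antisym: "cay_le S a b \<Longrightarrow> cay_le S b a \<Longrightarrow> a = b"
  using S_pointed[of "b - a"] by (simp add: cay_le_def)

lemma cay_le_minus: "x \<in> S \<Longrightarrow> cay_le S (a - x) a"
  by (simp add: cay_le_def)

lemma meet_eqI: "is_cay_product S b c m \<Longrightarrow> meet b c = m"
  unfolding cay_product_def
  by (rule the_equality) (auto simp: is_cay_product_def intro: cay_le_antisym)

lemma meet_is_product: "is_cay_product S b c (meet b c)"
  using products meet_eqI by metis

lemma meet_le: "cay_le S (meet b c) b" "cay_le S (meet b c) c"
  and le_meet: "cay_le S l b \<Longrightarrow> cay_le S l c \<Longrightarrow> cay_le S l (meet b c)"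
  using meet_is_product[of b c] by (auto simp: is_cay_product_def)

lemma meet_leI1: "cay_le S b x \<Longrightarrow> cay_le S (meet b c) x"
  and meet_leI2: "cay_le S c x \<Longrightarrow> cay_le S (meet b c) x"
  using cay_le_trans[OF meet_le(1)] cay_le_trans[OF meet_le(2)] by simp_all

lemma meet_assoc: "meet (meet a b) c = meet a (meet b c)"
  by (intro cay_le_antisym le_meet) (blast intro: meet_le meet_leI1 meet_leI2)+

lemma meet_mono: "cay_le S a b \<Longrightarrow> cay_le S a' b' \<Longrightarrow> cay_le S (meet a a') (meet b b')"
  by (intro le_meet meet_leI1 meet_leI2)

section \<open>Restriction between the complexes of the persistence object\<close>

lemma simplicial_K: "simplicial_complex (K a)"
  and simplicial_map: "cay_le S a b \<Longrightarrow> simplicial_map (K a) (K b) (\<phi> a b)"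
  and \<phi>_id: "v \<in> \<Union>(K a) \<Longrightarrow> \<phi> a a v = v"
  and \<phi>_comp: "cay_le S a b \<Longrightarrow> cay_le S b c \<Longrightarrow> v \<in> \<Union>(K a) \<Longrightarrow> \<phi> a c v = \<phi> b c (\<phi> a b v)"
  using complex unfolding cayley_persistence_complex_def by blast+

lemma res_closed: "cay_le S a b \<Longrightarrow> X \<in> coh b n \<Longrightarrow> res n a b X \<in> coh a n"
  by (rule induced_closed[OF simplicial_K simplicial_map])

lemma res_add: "cay_le S a b \<Longrightarrow> X \<in> coh b n \<Longrightarrow> Y \<in> coh b n \<Longrightarrow>
    res n a b (class_add X Y) = class_add (res n a b X) (res n a b Y)"
  by (rule induced_add[OF simplicial_K simplicial_map])

lemma res_scale: "cay_le S a b \<Longrightarrow> X \<in> coh b n \<Longrightarrow>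
    res n a b (class_scale (K b) n t X) = class_scale (K a) n t (res n a b X)"
  by (rule induced_scale[OF simplicial_K simplicial_map])

lemma res_zero: "cay_le S a b \<Longrightarrow> res n a b (zero_class b n) = zero_class a n"
  by (rule induced_zero[OF simplicial_K simplicial_map])

lemma res_id: "X \<in> coh a n \<Longrightarrow> res n a a X = X"
  by (rule induced_id[OF simplicial_K \<phi>_id])

lemma res_res: "cay_le S a b \<Longrightarrow> cay_le S b c \<Longrightarrow> X \<in> coh c n \<Longrightarrow> res n a b (res n b c X) = res n a c X"
  by (rule induced_comp[OF simplicial_K simplicial_map simplicial_K simplicial_map])
    (auto intro: \<phi>_comp simplicial_map cay_le_trans)

lemma res_cup: "cay_le S a b \<Longrightarrow> X \<in> coh b p \<Longrightarrow> Y \<in> coh b q \<Longrightarrow>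
    res (p + q) a b (class_cup (K b) p q X Y) = class_cup (K a) p q (res p a b X) (res q a b Y)"
  by (rule induced_class_cup[OF simplicial_K simplicial_K simplicial_map])

section \<open>The direct sum of all cohomology groups\<close>

lemma coh_carrier_iff:
  "h \<in> carrier G \<longleftrightarrow> (\<forall>a n. h a n \<in> coh a n) \<and> finite (coh_support K h)"
  by (simp add: coh_group_def)

lemma coh_component: "h \<in> carrier G \<Longrightarrow> h a n \<in> coh a n"
  by (simp add: coh_carrier_iff)

lemma coh_finite_support: "h \<in> carrier G \<Longrightarrow> finite (coh_support K h)"
  by (simp add: coh_carrier_iff)

lemma coh_add: "(h \<oplus>\<^bsub>G\<^esub> h') a n = class_add (h a n) (h' a n)"
  by (simp add: coh_group_def)

lemma coh_zero: "\<zero>\<^bsub>G\<^esub> a n = zero_class a n"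
  by (simp add: coh_group_def)

lemma coh_zero_in: "zero_class a n \<in> coh a n"
  by (rule coboundaries_in_cohomology)

lemma coh_scale: "coh_scale K t h a n = class_scale (K a) n t (h a n)"
  by (simp add: coh_scale_def)

lemma coh_scale_closed: "h \<in> carrier G \<Longrightarrow> coh_scale K t h \<in> carrier G"
  unfolding coh_carrier_iff
  by (auto simp: coh_scale coh_support_def class_scale_closed class_scale_zero
      elim: finite_subset[rotated])

lemma coh_abelian_group: "abelian_group G"
proof (rule abelian_groupI)
  fix x y z assume x: "x \<in> carrier G"
  show "\<exists>w\<in>carrier G. w \<oplus>\<^bsub>G\<^esub> x = \<zero>\<^bsub>G\<^esub>"
    using coh_scale_closed[OF x, of "- 1"] coh_component[OF x]
    by (intro bexI[of _ "coh_scale K (- 1) x"])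
      (auto simp: fun_eq_iff coh_add coh_zero coh_scale class_add_minus)
  show "\<zero>\<^bsub>G\<^esub> \<oplus>\<^bsub>G\<^esub> x = x"
    using coh_component[OF x] by (simp add: fun_eq_iff coh_add coh_zero class_add_zero)
  assume y: "y \<in> carrier G"
  show "x \<oplus>\<^bsub>G\<^esub> y = y \<oplus>\<^bsub>G\<^esub> x"
    unfolding fun_eq_iff coh_add
    by (intro allI class_add_commute[OF coh_component[OF x] coh_component[OF y]])
  have "coh_support K (x \<oplus>\<^bsub>G\<^esub> y) \<subseteq> coh_support K x \<union> coh_support K y"
    by (auto simp: coh_support_def coh_add class_add_zero coh_zero_in)
  then show "x \<oplus>\<^bsub>G\<^esub> y \<in> carrier G"
    using x y unfolding coh_carrier_iff
    by (auto simp: coh_add class_add_closed elim: finite_subset)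
  assume z: "z \<in> carrier G"
  show "x \<oplus>\<^bsub>G\<^esub> y \<oplus>\<^bsub>G\<^esub> z = x \<oplus>\<^bsub>G\<^esub> (y \<oplus>\<^bsub>G\<^esub> z)"
    unfolding fun_eq_iff coh_add
    by (intro allI class_add_assoc[OF coh_component[OF x] coh_component[OF y] coh_component[OF z]])
next
  have "coh_support K \<zero>\<^bsub>G\<^esub> = {}" by (simp add: coh_support_def coh_zero)
  then show "\<zero>\<^bsub>G\<^esub> \<in> carrier G" by (simp add: coh_carrier_iff coh_zero coh_zero_in)
qed

sublocale G: abelian_group G
  by (rule coh_abelian_group)

text \<open>Tailored to decompositions in which at most one summand is nonzero at a given place:
  sums of single classes, with \<open>j\<close> the pair (a, n), and sums of homogeneous parts, with
  \<open>j\<close> the degree - a.\<close>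

lemma finsum_component:
  assumes "finite D" "F \<in> D \<rightarrow> carrier G"
    and "\<And>i. i \<in> D \<Longrightarrow> i \<noteq> j \<Longrightarrow> F i a n = zero_class a n"
  shows "finsum G F D a n = (if j \<in> D then F j a n else zero_class a n)"
  using assms
proof (induction D)
  case (insert i D)
  then have F: "F i \<in> carrier G" "F \<in> D \<rightarrow> carrier G" by auto
  then have eq: "finsum G F (insert i D) a n = class_add (F i a n) (finsum G F D a n)"
    using insert.hyps by (simp add: coh_add)
  have IH: "finsum G F D a n = (if j \<in> D then F j a n else zero_class a n)"
    using insert F by simp
  show ?case
  proof (cases "j = i")
    case True
    then show ?thesis
      unfolding eq IH using insert.hyps F by (simp add: class_add_zero_right coh_component)
  next
    case False
    then have "F i a n = zero_class a n" using insert.prems by simp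
    then show ?thesis
      unfolding eq IH using False insert.prems coh_component
      by (simp add: class_add_zero coh_zero_in Pi_iff)
  qed
qed (simp add: coh_zero)

lemma inj_component:
  "inj a n X b m = (if b = a \<and> m = n then X else zero_class b m)"
  by (simp add: coh_inject_def)

lemma inj_closed: "X \<in> coh a n \<Longrightarrow> inj a n X \<in> carrier G"
proof -
  assume X: "X \<in> coh a n"
  have "coh_support K (inj a n X) \<subseteq> {(a, n)}" by (auto simp: coh_support_def inj_component)
  then show ?thesis
    using X finite_subset by (auto simp: coh_carrier_iff inj_component coh_zero_in)
qed

lemma inj_add:
  "X \<in> coh a n \<Longrightarrow> Y \<in> coh a n \<Longrightarrow> inj a n (class_add X Y) = inj a n X \<oplus>\<^bsub>G\<^esub> inj a n Y"
  by (auto simp: fun_eq_iff coh_add inj_component class_add_zero coh_zero_in)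

lemma inj_zero: "inj a n (zero_class a n) = \<zero>\<^bsub>G\<^esub>"
  by (auto simp: fun_eq_iff coh_zero inj_component)

lemma coh_eq_finsum_inj:
  assumes "h \<in> carrier G"
  shows "h = (\<Oplus>\<^bsub>G\<^esub> i \<in> coh_support K h. inj (fst i) (snd i) (h (fst i) (snd i)))"
proof (intro ext)
  fix a n
  let ?F = "\<lambda>i. inj (fst i) (snd i) (h (fst i) (snd i))"
  have "finsum G ?F (coh_support K h) a n =
      (if (a, n) \<in> coh_support K h then ?F (a, n) a n else zero_class a n)"
  proof (rule finsum_component)
    show "?F \<in> coh_support K h \<rightarrow> carrier G" using assms by (simp add: inj_closed coh_component)
    show "?F i a n = zero_class a n" if "i \<noteq> (a, n)" for i
      using that by (cases i) (auto simp: inj_component)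
  qed (rule coh_finite_support[OF assms])
  also have "\<dots> = h a n" by (simp add: inj_component coh_support_def)
  finally show "h a n = finsum G ?F (coh_support K h) a n" ..
qed

text \<open>Every element is a finite sum of single classes. The set \<open>T\<close> keeps track of
  the objects at which they live: \<open>UNIV\<close> gives \<open>coh_induct\<close>, and
  \<open>{- d}\<close> gives \<open>degree_induct\<close> for homogeneous elements.\<close>

lemma coh_induct_on [consumes 2, case_names zero inj add]:
  assumes h: "h \<in> carrier G" and T: "\<And>a n. a \<notin> T \<Longrightarrow> h a n = zero_class a n"
    and zero: "P \<zero>\<^bsub>G\<^esub>"
    and inj: "\<And>a n X. a \<in> T \<Longrightarrow> X \<in> coh a n \<Longrightarrow> P (inj a n X)"
    and add: "\<And>h h'. h \<in> carrier G \<Longrightarrow> h' \<in> carrier G \<Longrightarrow> P h \<Longrightarrow> P h' \<Longrightarrow> P (h \<oplus>\<^bsub>G\<^esub> h')"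
  shows "P h"
proof -
  have "P (\<Oplus>\<^bsub>G\<^esub> i \<in> A. inj (fst i) (snd i) (h (fst i) (snd i)))"
    if "finite A" "A \<subseteq> coh_support K h" for A
    using that
  proof (induction A)
    case (insert i A)
    have "fst i \<in> T" using T insert.prems by (cases i) (auto simp: coh_support_def)
    then have "P (inj (fst i) (snd i) (h (fst i) (snd i)))" by (intro inj coh_component h)
    moreover have "(\<lambda>i. inj (fst i) (snd i) (h (fst i) (snd i))) \<in> A \<rightarrow> carrier G"
      by (intro Pi_I inj_closed coh_component h)
    ultimately show ?case
      using insert h by (simp add: add inj_closed coh_component)
  qed (simp add: zero)
  from this[OF coh_finite_support[OF h] order.refl] show ?thesis
    by (simp only: coh_eq_finsum_inj[OF h, symmetric])
qed

lemma coh_induct [consumes 1, case_names zero inj add]: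
  assumes "h \<in> carrier G" and "P \<zero>\<^bsub>G\<^esub>"
    and "\<And>a n X. X \<in> coh a n \<Longrightarrow> P (inj a n X)"
    and "\<And>h h'. h \<in> carrier G \<Longrightarrow> h' \<in> carrier G \<Longrightarrow> P h \<Longrightarrow> P h' \<Longrightarrow> P (h \<oplus>\<^bsub>G\<^esub> h')"
  shows "P h"
  by (rule coh_induct_on[of h UNIV P]) (use assms in auto)

section \<open>The action of the monoid ring\<close>

lemma persist_closed:
  assumes x: "x \<in> S" and h: "h \<in> carrier G"
  shows "persist K \<phi> x h \<in> carrier G"
proof -
  have le: "cay_le S a (x + a)" for a using x by (simp add: cay_le_def)
  \<comment> \<open>The component at a comes from x + a, and zero classes restrict to zero classes,
    so the support is merely moved by - x.\<close>
  have "coh_support K (persist K \<phi> x h) \<subseteq> (\<lambda>(a, n). (a - x, n)) ` coh_support K h"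
  proof clarify
    fix a n assume "(a, n) \<in> coh_support K (persist K \<phi> x h)"
    then have "h (x + a) n \<noteq> zero_class (x + a) n"
      using res_zero[OF le[of a], of n] by (auto simp: coh_support_def persist_def)
    then show "(a, n) \<in> (\<lambda>(a, n). (a - x, n)) ` coh_support K h"
      by (intro image_eqI[of _ _ "(x + a, n)"]) (simp_all add: coh_support_def)
  qed
  then show ?thesis
    using h unfolding coh_carrier_iff
    by (auto simp: persist_def intro!: res_closed[OF le] elim: finite_subset)
qed

lemma persist_add:
  assumes x: "x \<in> S" and h: "h \<in> carrier G" "h' \<in> carrier G"
  shows "persist K \<phi> x (h \<oplus>\<^bsub>G\<^esub> h') = persist K \<phi> x h \<oplus>\<^bsub>G\<^esub> persist K \<phi> x h'"
proof -
  have le: "cay_le S a (x + a)" for a using x by (simp add: cay_le_def)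
  show ?thesis using h by (simp add: fun_eq_iff persist_def coh_add res_add[OF le] coh_component)
qed

lemma coh_scale_add:
  "h \<in> carrier G \<Longrightarrow> h' \<in> carrier G \<Longrightarrow>
    coh_scale K t (h \<oplus>\<^bsub>G\<^esub> h') = coh_scale K t h \<oplus>\<^bsub>G\<^esub> coh_scale K t h'"
  by (simp add: fun_eq_iff coh_scale coh_add class_scale_add coh_component)

lemma coh_scale_add_scalar:
  "h \<in> carrier G \<Longrightarrow> coh_scale K (t + u) h = coh_scale K t h \<oplus>\<^bsub>G\<^esub> coh_scale K u h"
  by (simp add: fun_eq_iff coh_scale coh_add class_scale_add_scalar coh_component)

lemma coh_scale_zero: "h \<in> carrier G \<Longrightarrow> coh_scale K 0 h = \<zero>\<^bsub>G\<^esub>"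
  by (simp add: fun_eq_iff coh_scale coh_zero class_scale_zero_scalar coh_component)

lemma R_carrier_iff: "r \<in> carrier R \<longleftrightarrow> Poly_Mapping.keys r \<subseteq> S"
  by (simp add: persistence_ring_def)

lemma R_simps: "r \<oplus>\<^bsub>R\<^esub> s = r + s" "r \<otimes>\<^bsub>R\<^esub> s = r * s" "\<zero>\<^bsub>R\<^esub> = 0" "\<one>\<^bsub>R\<^esub> = 1"
  by (simp_all add: persistence_ring_def)

lemma R_add_closed: "r \<in> carrier R \<Longrightarrow> s \<in> carrier R \<Longrightarrow> r + s \<in> carrier R"
  using Poly_Mapping.keys_add[of r s] by (auto simp: R_carrier_iff)

lemma R_mult_closed: "r \<in> carrier R \<Longrightarrow> s \<in> carrier R \<Longrightarrow> r * s \<in> carrier R"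
  using Poly_Mapping.keys_mult[of r s] by (force simp: R_carrier_iff intro: add_in_S)

lemma R_single_closed: "x \<in> S \<Longrightarrow> Poly_Mapping.single x t \<in> carrier R"
  by (simp add: R_carrier_iff)

text \<open>Keys may cancel in a sum of ring elements, so additivity is proved over a common finite
  index set; the extra indices contribute multiples by 0.\<close>

lemma act_eq:
  assumes "finite A" "Poly_Mapping.keys r \<subseteq> A" "A \<subseteq> S" "h \<in> carrier G"
  shows "act r h = (\<Oplus>\<^bsub>G\<^esub> x \<in> A. coh_scale K (Poly_Mapping.lookup r x) (persist K \<phi> x h))"
  unfolding coh_action_def using assms
  by (intro G.add.finprod_mono_neutral_cong_left)
    (auto simp: in_keys_iff coh_scale_zero persist_closed intro!: coh_scale_closed persist_closed)

lemma act_closed: "r \<in> carrier R \<Longrightarrow> h \<in> carrier G \<Longrightarrow> act r h \<in> carrier G"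
  unfolding coh_action_def R_carrier_iff
  by (intro G.finsum_closed Pi_I coh_scale_closed persist_closed) blast+

lemma act_term_closed:
  "x \<in> S \<Longrightarrow> h \<in> carrier G \<Longrightarrow> coh_scale K t (persist K \<phi> x h) \<in> carrier G"
  by (intro coh_scale_closed persist_closed)

lemma act_add_left:
  assumes "r \<in> carrier R" "s \<in> carrier R" "h \<in> carrier G"
  shows "act (r + s) h = act r h \<oplus>\<^bsub>G\<^esub> act s h"
proof -
  let ?A = "Poly_Mapping.keys r \<union> Poly_Mapping.keys s"
  let ?f = "\<lambda>r x. coh_scale K (Poly_Mapping.lookup r x) (persist K \<phi> x h)"
  have A: "finite ?A" "?A \<subseteq> S" using assms by (auto simp: R_carrier_iff)
  then have f: "?f u \<in> ?A \<rightarrow> carrier G" for u using assms(3) act_term_closed by blast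
  have eq: "act u h = finsum G (?f u) ?A" if "Poly_Mapping.keys u \<subseteq> ?A" for u
    by (rule act_eq[OF A(1) that A(2) assms(3)])
  have "?f (r + s) x = ?f r x \<oplus>\<^bsub>G\<^esub> ?f s x" if "x \<in> ?A" for x
    using A(2) that assms(3)
    by (simp only: lookup_add) (intro coh_scale_add_scalar persist_closed; blast)
  then have "act (r + s) h = (\<Oplus>\<^bsub>G\<^esub> x \<in> ?A. ?f r x \<oplus>\<^bsub>G\<^esub> ?f s x)"
    unfolding eq[OF Poly_Mapping.keys_add] using f by (intro G.finsum_cong') blast+
  also have "\<dots> = act r h \<oplus>\<^bsub>G\<^esub> act s h"
    using G.finsum_addf[OF f f] by (simp only: eq Un_upper1 Un_upper2)
  finally show ?thesis .
qed

lemma act_add_right: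
  assumes "r \<in> carrier R" "h \<in> carrier G" "h' \<in> carrier G"
  shows "act r (h \<oplus>\<^bsub>G\<^esub> h') = act r h \<oplus>\<^bsub>G\<^esub> act r h'"
proof -
  let ?A = "Poly_Mapping.keys r"
  let ?f = "\<lambda>h x. coh_scale K (Poly_Mapping.lookup r x) (persist K \<phi> x h)"
  have A: "?A \<subseteq> S" using assms by (auto simp: R_carrier_iff)
  then have f: "?f h \<in> ?A \<rightarrow> carrier G" "?f h' \<in> ?A \<rightarrow> carrier G"
    using assms(2,3) act_term_closed by blast+
  have "?f (h \<oplus>\<^bsub>G\<^esub> h') x = ?f h x \<oplus>\<^bsub>G\<^esub> ?f h' x" if "x \<in> ?A" for x
  proof -
    have x: "x \<in> S" using that A by blast
    show ?thesis
      unfolding persist_add[OF x assms(2,3)]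
      by (rule coh_scale_add) (use assms x in \<open>auto intro: persist_closed\<close>)
  qed
  then have "act r (h \<oplus>\<^bsub>G\<^esub> h') = (\<Oplus>\<^bsub>G\<^esub> x \<in> ?A. ?f h x \<oplus>\<^bsub>G\<^esub> ?f h' x)"
    unfolding coh_action_def using f by (intro G.finsum_cong') blast+
  also have "\<dots> = act r h \<oplus>\<^bsub>G\<^esub> act r h'"
    unfolding coh_action_def by (rule G.finsum_addf[OF f])
  finally show ?thesis .
qed

lemma act_zero_left: "act 0 h = \<zero>\<^bsub>G\<^esub>"
  by (simp add: coh_action_def)

lemma act_zero_right: "r \<in> carrier R \<Longrightarrow> act r \<zero>\<^bsub>G\<^esub> = \<zero>\<^bsub>G\<^esub>"
  using act_add_right[of r "\<zero>\<^bsub>G\<^esub>" "\<zero>\<^bsub>G\<^esub>"] act_closed[of r "\<zero>\<^bsub>G\<^esub>"]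
  by simp

text \<open>The formula on basis elements to which the laws of the action are reduced. The component
  at b reads the one at x + b, hence a class at a lands at a - x.\<close>

lemma act_single_inj:
  assumes x: "x \<in> S" and X: "X \<in> coh a n"
  shows "act (Poly_Mapping.single x t) (inj a n X) =
    inj (a - x) n (class_scale (K (a - x)) n t (res n (a - x) a X))"
proof -
  have le: "cay_le S b (x + b)" for b using x by (simp add: cay_le_def)
  have "act (Poly_Mapping.single x t) (inj a n X) = coh_scale K t (persist K \<phi> x (inj a n X))"
    using x X act_eq[of "{x}" "Poly_Mapping.single x t" "inj a n X"]
    by (simp add: inj_closed coh_scale_closed persist_closed)
  also have "\<dots> = inj (a - x) n (class_scale (K (a - x)) n t (res n (a - x) a X))"
    by (auto simp: fun_eq_iff coh_scale persist_def inj_component res_zero[OF le] class_scale_zero)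
  finally show ?thesis .
qed

section \<open>Products of single classes at different objects\<close>

definition pcup ::
  "'g \<Rightarrow> int \<Rightarrow> 'g \<Rightarrow> int \<Rightarrow> ('v list \<Rightarrow> 'k) set \<Rightarrow> ('v list \<Rightarrow> 'k) set \<Rightarrow> ('v list \<Rightarrow> 'k) set" where
  "pcup b p c q X Y =
    class_cup (K (meet b c)) p q (res p (meet b c) b X) (res q (meet b c) c Y)"

lemma pcup_eq: "persistence_cup_class S K \<phi> = pcup"
  by (intro ext) (simp add: pcup_def persistence_cup_class_def Let_def)

lemma pcup_closed: "X \<in> coh b p \<Longrightarrow> Y \<in> coh c q \<Longrightarrow> pcup b p c q X Y \<in> coh (meet b c) (p + q)"
  by (simp add: pcup_def class_cup_closed[OF simplicial_K] res_closed meet_le)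

lemma pcup_add_left:
  "X \<in> coh b p \<Longrightarrow> X' \<in> coh b p \<Longrightarrow> Y \<in> coh c q \<Longrightarrow>
    pcup b p c q (class_add X X') Y = class_add (pcup b p c q X Y) (pcup b p c q X' Y)"
  by (simp add: pcup_def class_cup_add_left[OF simplicial_K] res_add res_closed meet_le)

lemma pcup_add_right:
  "X \<in> coh b p \<Longrightarrow> Y \<in> coh c q \<Longrightarrow> Y' \<in> coh c q \<Longrightarrow>
    pcup b p c q X (class_add Y Y') = class_add (pcup b p c q X Y) (pcup b p c q X Y')"
  by (simp add: pcup_def class_cup_add_right[OF simplicial_K] res_add res_closed meet_le)

lemma pcup_zero_left:
  "Y \<in> coh c q \<Longrightarrow> pcup b p c q (zero_class b p) Y = zero_class (meet b c) (p + q)"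
  by (simp add: pcup_def class_cup_zero_left[OF simplicial_K] res_zero res_closed meet_le)

lemma pcup_zero_right:
  "X \<in> coh b p \<Longrightarrow> pcup b p c q X (zero_class c q) = zero_class (meet b c) (p + q)"
  by (simp add: pcup_def class_cup_zero_right[OF simplicial_K] res_zero res_closed meet_le)

lemma pcup_assoc:
  assumes X: "X \<in> coh a p" and Y: "Y \<in> coh b q" and Z: "Z \<in> coh c r"
  shows "pcup (meet a b) (p + q) c r (pcup a p b q X Y) Z =
    pcup a p (meet b c) (q + r) X (pcup b q c r Y Z)"
proof -
  \<comment> \<open>All three classes are restricted to this object, where associativity on a single
    complex applies.\<close>
  let ?m = "meet a (meet b c)"
  have le: "cay_le S ?m (meet a b)" "cay_le S ?m (meet b c)" "cay_le S ?m a" "cay_le S ?m b"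
    "cay_le S ?m c"
    by (simp_all add: le_meet meet_le meet_leI1 meet_leI2)
  have "pcup (meet a b) (p + q) c r (pcup a p b q X Y) Z =
      class_cup (K ?m) (p + q) r (class_cup (K ?m) p q (res p ?m a X) (res q ?m b Y))
        (res r ?m c Z)"
    \<comment> \<open>Only the outer product is unfolded at first, so that its object becomes
      \<open>?m\<close> before the inner product is restricted there.\<close>
    using le X Y Z by (simp add: pcup_def[of "meet a b"] meet_assoc)
      (simp add: pcup_def res_cup res_closed meet_le res_res)
  also have "\<dots> =
      class_cup (K ?m) p (q + r) (res p ?m a X)
        (class_cup (K ?m) q r (res q ?m b Y) (res r ?m c Z))"
    using le X Y Z by (simp add: class_cup_assoc[OF simplicial_K] res_closed)
  also have "\<dots> = pcup a p (meet b c) (q + r) X (pcup b q c r Y Z)"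
    using le X Y Z by (simp add: pcup_def[of a])
      (simp add: pcup_def res_cup res_closed meet_le res_res)
  finally show ?thesis .
qed

text \<open>The core of the twisting law. Restriction to the smaller meet factors through the larger
  one, and naturality moves it outside the product.\<close>

lemma pcup_scale_res:
  assumes X: "X \<in> coh b p" and Y: "Y \<in> coh c q" and le: "cay_le S b' b" "cay_le S c' c"
  shows "pcup b' p c' q (class_scale (K b') p t (res p b' b X))
      (class_scale (K c') q u (res q c' c Y)) =
    class_scale (K (meet b' c')) (p + q) (t * u)
      (res (p + q) (meet b' c') (meet b c) (pcup b p c q X Y))"
proof -
  let ?m = "meet b c" and ?n = "meet b' c'"
  have le': "cay_le S ?n ?m" "cay_le S ?n b" "cay_le S ?n c"
    using le meet_mono cay_le_trans meet_le by blast+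
  show ?thesis
    using X Y le le'
    by (simp add: pcup_def res_scale res_closed meet_le res_res res_cup
        class_cup_scale[OF simplicial_K])
qed

section \<open>The persistence-cup product on the whole direct sum\<close>

definition cup_term ::
  "('g, 'v, 'k) coh \<Rightarrow> ('g, 'v, 'k) coh \<Rightarrow> ('g \<times> int) \<times> ('g \<times> int) \<Rightarrow> ('g, 'v, 'k) coh" where
  "cup_term h h' =
    (\<lambda>((b, p), (c, q)). inj (meet b c) (p + q) (pcup b p c q (h b p) (h' c q)))"

lemma cup_term_closed: "h \<in> carrier G \<Longrightarrow> h' \<in> carrier G \<Longrightarrow> cup_term h h' ij \<in> carrier G"
  by (cases ij; cases "fst ij"; cases "snd ij")
    (simp add: cup_term_def inj_closed pcup_closed coh_component)

text \<open>Supports may shrink under addition, so biadditivity needs index sets common to all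
  summands; off the supports a factor is a zero class and so is the product.\<close>

lemma cup_eq:
  assumes "finite A" "coh_support K h \<subseteq> A" "finite B" "coh_support K h' \<subseteq> B"
    and h: "h \<in> carrier G" "h' \<in> carrier G"
  shows "cup h h' = finsum G (cup_term h h') (A \<times> B)"
proof -
  have "cup h h' = finsum G (cup_term h h') (coh_support K h \<times> coh_support K h')"
    unfolding persistence_cup_def pcup_eq cup_term_def
    by (intro arg_cong[where f = "\<lambda>F. finsum G F _"] ext) (simp split: prod.split)
  also have "\<dots> = finsum G (cup_term h h') (A \<times> B)"
  proof (rule G.add.finprod_mono_neutral_cong_left)
    show "cup_term h h' ij = \<zero>\<^bsub>G\<^esub>" if "ij \<in> A \<times> B - coh_support K h \<times> coh_support K h'" for ij
      using that h
      by (auto simp: cup_term_def coh_support_def pcup_zero_left pcup_zero_right coh_component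
          inj_zero)
  qed (use assms cup_term_closed in auto)
  finally show ?thesis .
qed

lemma cup_closed: "h \<in> carrier G \<Longrightarrow> h' \<in> carrier G \<Longrightarrow> cup h h' \<in> carrier G"
  using cup_eq[OF coh_finite_support order.refl coh_finite_support order.refl, of h h']
    G.finsum_closed[of "cup_term h h'" "coh_support K h \<times> coh_support K h'"]
  by (simp add: cup_term_closed)

lemma coh_support_add: "coh_support K (h \<oplus>\<^bsub>G\<^esub> h') \<subseteq> coh_support K h \<union> coh_support K h'"
  by (auto simp: coh_support_def coh_add class_add_zero coh_zero_in)

lemma cup_add_left:
  assumes h: "h \<in> carrier G" "h' \<in> carrier G" "u \<in> carrier G"
  shows "cup (h \<oplus>\<^bsub>G\<^esub> h') u = cup h u \<oplus>\<^bsub>G\<^esub> cup h' u"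
proof -
  let ?A = "coh_support K h \<union> coh_support K h'" and ?B = "coh_support K u"
  have fin: "finite ?A" "finite ?B" using h by (auto simp: coh_finite_support)
  have "cup_term (h \<oplus>\<^bsub>G\<^esub> h') u =
      (\<lambda>ij. cup_term h u ij \<oplus>\<^bsub>G\<^esub> cup_term h' u ij)"
    using h by (intro ext)
      (auto simp: cup_term_def coh_add pcup_add_left pcup_closed coh_component inj_add
        split: prod.split)
  then show ?thesis
    using h coh_support_add[of h h']
    by (simp add: cup_eq[OF fin(1) _ fin(2)] G.finsum_addf cup_term_closed Pi_def)
qed

lemma cup_add_right:
  assumes h: "h \<in> carrier G" "h' \<in> carrier G" "u \<in> carrier G"
  shows "cup u (h \<oplus>\<^bsub>G\<^esub> h') = cup u h \<oplus>\<^bsub>G\<^esub> cup u h'"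
proof -
  let ?A = "coh_support K h \<union> coh_support K h'" and ?B = "coh_support K u"
  have fin: "finite ?A" "finite ?B" using h by (auto simp: coh_finite_support)
  have "cup_term u (h \<oplus>\<^bsub>G\<^esub> h') =
      (\<lambda>ij. cup_term u h ij \<oplus>\<^bsub>G\<^esub> cup_term u h' ij)"
    using h by (intro ext)
      (auto simp: cup_term_def coh_add pcup_add_right pcup_closed coh_component inj_add
        split: prod.split)
  then show ?thesis
    using h coh_support_add[of h h']
    by (simp add: cup_eq[OF fin(2) _ fin(1)] G.finsum_addf cup_term_closed Pi_def)
qed

lemma cup_zero_left: "h \<in> carrier G \<Longrightarrow> cup \<zero>\<^bsub>G\<^esub> h = \<zero>\<^bsub>G\<^esub>"
  using cup_add_left[of "\<zero>\<^bsub>G\<^esub>" "\<zero>\<^bsub>G\<^esub>" h] cup_closed[of "\<zero>\<^bsub>G\<^esub>" h] by simp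

lemma cup_zero_right: "h \<in> carrier G \<Longrightarrow> cup h \<zero>\<^bsub>G\<^esub> = \<zero>\<^bsub>G\<^esub>"
  using cup_add_right[of "\<zero>\<^bsub>G\<^esub>" "\<zero>\<^bsub>G\<^esub>" h] cup_closed[of h "\<zero>\<^bsub>G\<^esub>"] by simp

lemma cup_inj:
  assumes X: "X \<in> coh b p" and Y: "Y \<in> coh c q"
  shows "cup (inj b p X) (inj c q Y) = inj (meet b c) (p + q) (pcup b p c q X Y)"
proof -
  have "coh_support K (inj b p X) \<subseteq> {(b, p)}" "coh_support K (inj c q Y) \<subseteq> {(c, q)}"
    by (auto simp: coh_support_def inj_component)
  from cup_eq[OF _ this(1) _ this(2)] assms
  have "cup (inj b p X) (inj c q Y) =
      finsum G (cup_term (inj b p X) (inj c q Y)) {((b, p), (c, q))}"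
    by (simp add: inj_closed)
  also have "\<dots> = cup_term (inj b p X) (inj c q Y) ((b, p), (c, q))"
    using assms by (simp add: cup_term_closed inj_closed)
  finally show ?thesis by (simp add: cup_term_def inj_component)
qed

lemma cup_assoc:
  assumes u: "u \<in> carrier G" and v: "v \<in> carrier G" and w: "w \<in> carrier G"
  shows "cup (cup u v) w = cup u (cup v w)"
  using u
proof (induction u rule: coh_induct)
  case zero
  then show ?case using v w by (simp add: cup_zero_left cup_closed)
next
  case (add u u')
  then show ?case using v w by (simp add: cup_add_left cup_closed)
next
  case X: (inj a p X)
  show ?case using v
  proof (induction v rule: coh_induct)
    case zero
    then show ?case using X w by (simp add: cup_zero_left cup_zero_right inj_closed cup_closed)
  next
    case (add v v')
    then show ?case
      using X w by (simp add: cup_add_left cup_add_right inj_closed cup_closed)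
  next
    case Y: (inj b q Y)
    show ?case using w
    proof (induction w rule: coh_induct)
      case zero
      then show ?case using X Y by (simp add: cup_zero_right inj_closed cup_closed)
    next
      case (add w w')
      then show ?case using X Y by (simp add: cup_add_right inj_closed cup_closed)
    next
      case (inj c r Z)
      then show ?case
        using X Y by (simp add: cup_inj pcup_closed pcup_assoc meet_assoc add.assoc)
    qed
  qed
qed

section \<open>The monoid ring and the module over it\<close>

lemma R_cring: "cring R"
proof (rule cringI)
  show "abelian_group R"
  proof (rule abelian_groupI)
    fix r assume "r \<in> carrier R"
    then show "\<exists>s \<in> carrier R. s \<oplus>\<^bsub>R\<^esub> r = \<zero>\<^bsub>R\<^esub>"
      by (intro bexI[of _ "- r"]) (simp_all add: R_simps R_carrier_iff)
  qed (auto simp: R_simps R_add_closed add.assoc add.commute R_carrier_iff[of 0])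
  have "1 \<in> carrier R" by (simp add: R_carrier_iff zero_in_S flip: single_one)
  then show "comm_monoid R"
    by (intro comm_monoidI) (auto simp: R_simps R_mult_closed mult.assoc mult.commute)
qed (simp add: R_simps distrib_right)

sublocale R: cring R
  by (rule R_cring)

lemma R_finsum: "finite A \<Longrightarrow> F \<in> A \<rightarrow> carrier R \<Longrightarrow> finsum R F A = sum F A"
  by (induction A rule: finite_induct) (simp_all add: R_simps)

lemma R_sum_closed: "finite A \<Longrightarrow> F \<in> A \<rightarrow> carrier R \<Longrightarrow> sum F A \<in> carrier R"
  using R.finsum_closed[of F A] by (simp add: R_finsum)

lemma R_induct [consumes 1, case_names zero single add]:
  assumes r: "r \<in> carrier R" and zero: "P 0"
    and single: "\<And>x t. x \<in> S \<Longrightarrow> P (Poly_Mapping.single x t)"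
    and add: "\<And>r s. r \<in> carrier R \<Longrightarrow> s \<in> carrier R \<Longrightarrow> P r \<Longrightarrow> P s \<Longrightarrow> P (r + s)"
  shows "P r"
proof -
  let ?f = "\<lambda>x. Poly_Mapping.single x (Poly_Mapping.lookup r x)"
  have "P (sum ?f A)" if "finite A" "A \<subseteq> S" for A
    using that
  proof (induction A)
    case (insert x A)
    then have "?f \<in> A \<rightarrow> carrier R" by (intro Pi_I R_single_closed) blast
    then have "sum ?f A \<in> carrier R" using insert.hyps by (intro R_sum_closed)
    with insert show ?case by (simp add: add single R_single_closed)
  qed (simp add: zero)
  from this[OF finite_keys[of r]] r show ?thesis
    by (simp only: R_carrier_iff poly_mapping_eq_sum_single[of r, symmetric])
qed

text \<open>Finite sums depend only on carrier, zero and addition, which the two records share. All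
  computations can therefore take place in \<open>G\<close>.\<close>

lemma H_simps:
  "carrier H = carrier G" "u \<oplus>\<^bsub>H\<^esub> v = u \<oplus>\<^bsub>G\<^esub> v" "\<zero>\<^bsub>H\<^esub> = \<zero>\<^bsub>G\<^esub>" "u \<otimes>\<^bsub>H\<^esub> v = cup u v"
  "r \<odot>\<^bsub>H\<^esub> u = act r u" "finsum H = finsum G"
  by (simp_all add: persistence_cohomology_def finsum_def finprod_def fun_eq_iff)

lemma H_abelian_group: "abelian_group H"
proof (rule abelian_groupI)
  fix u assume "u \<in> carrier H"
  then show "\<exists>v \<in> carrier H. v \<oplus>\<^bsub>H\<^esub> u = \<zero>\<^bsub>H\<^esub>"
    unfolding H_simps by (intro bexI[of _ "\<ominus>\<^bsub>G\<^esub> u"]) (simp_all add: G.l_neg)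
qed (simp_all add: H_simps G.a_ac)

lemma act_mult:
  assumes r: "r \<in> carrier R" and s: "s \<in> carrier R" and h: "h \<in> carrier G"
  shows "act (r * s) h = act r (act s h)"
  using r
proof (induction r rule: R_induct)
  case zero
  then show ?case by (simp add: act_zero_left)
next
  case (add r r')
  then show ?case using s h by (simp add: distrib_right act_add_left R_mult_closed act_closed)
next
  case x: (single x t)
  show ?case using s
  proof (induction s rule: R_induct)
    case zero
    then show ?case using x by (simp add: act_zero_left act_zero_right R_single_closed)
  next
    case (add s s')
    then show ?case using x h
      by (simp add: distrib_left act_add_left act_add_right R_mult_closed R_single_closed act_closed)
  next
    case y: (single y u)
    show ?case using h
    proof (induction h rule: coh_induct)
      case zero
      then show ?case
        using x y by (simp add: mult_single act_zero_right R_single_closed add_in_S)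
    next
      case (add h h')
      then show ?case
        using x y by (simp add: mult_single act_add_right R_single_closed add_in_S act_closed)
    next
      case (inj a n X)
      \<comment> \<open>The inner action by y comes first, so the class passes through a - y on its
        way to a - y - x.\<close>
      have eq: "a - (x + y) = a - y - x" by (simp add: algebra_simps)
      have le: "cay_le S (a - y - x) (a - y)" "cay_le S (a - y) a"
        "cay_le S (a - y - x) a"
        using x y by (auto intro: cay_le_minus cay_le_trans)
      show ?case
        using x y inj le
        by (simp add: mult_single act_single_inj add_in_S res_closed class_scale_closed res_scale
            class_scale_scale res_res eq)
    qed
  qed
qed

text \<open>The unit is the basis element at exponent 0, which acts by restriction along an identity
  map.\<close>

lemma act_one: "h \<in> carrier G \<Longrightarrow> act 1 h = h"
proof (induction h rule: coh_induct)
  case zero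
  then show ?case by (simp add: act_zero_right R_single_closed zero_in_S flip: single_one)
next
  case (inj a n X)
  then show ?case
    using act_single_inj[OF zero_in_S inj, of 1] by (simp add: res_id class_scale_one)
next
  case (add h h')
  then show ?case
    using R.one_closed by (simp add: act_add_right R_simps)
qed

lemma H_module: "module R H"
proof (rule moduleI)
  show "cring R" by (rule R_cring)
  show "abelian_group H" by (rule H_abelian_group)
qed (simp_all add: H_simps R_simps act_closed act_add_left act_add_right act_mult act_one)

section \<open>The gradings of the module and of the ring\<close>

lemma degree_iff:
  "h \<in> persistence_degree K d \<longleftrightarrow>
    h \<in> carrier G \<and> (\<forall>a n. a \<noteq> - d \<longrightarrow> h a n = zero_class a n)"
  by (simp add: persistence_degree_def)

lemma degree_induct [consumes 1, case_names zero inj add]: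
  assumes "h \<in> persistence_degree K d" and "P \<zero>\<^bsub>G\<^esub>"
    and "\<And>n X. X \<in> coh (- d) n \<Longrightarrow> P (inj (- d) n X)"
    and "\<And>h h'. h \<in> carrier G \<Longrightarrow> h' \<in> carrier G \<Longrightarrow> P h \<Longrightarrow> P h' \<Longrightarrow> P (h \<oplus>\<^bsub>G\<^esub> h')"
  shows "P h"
  by (rule coh_induct_on[of h "{- d}" P]) (use assms in \<open>auto simp: degree_iff\<close>)

lemma H_subgroup_degree: "subgroup (persistence_degree K d :: ('g, 'v, 'k) coh set) (add_monoid H)"
proof -
  interpret H: abelian_group H by (rule H_abelian_group)
  show ?thesis
  proof (rule H.add.subgroupI)
    show "persistence_degree K d \<subseteq> carrier H" by (auto simp: degree_iff H_simps)
    have "\<zero>\<^bsub>G\<^esub> \<in> persistence_degree K d" by (simp add: degree_iff coh_zero)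
    then show "(persistence_degree K d :: ('g, 'v, 'k) coh set) \<noteq> {}" by blast
  next
    fix h :: "('g, 'v, 'k) coh" assume h: "h \<in> persistence_degree K d"
    \<comment> \<open>Identifying the abstract group inverse with scaling by -1 makes its components
      visible.\<close>
    have "coh_scale K (- 1) h \<oplus>\<^bsub>G\<^esub> h = \<zero>\<^bsub>G\<^esub>"
      using h
        by (simp add: fun_eq_iff coh_add coh_zero coh_scale class_add_minus degree_iff coh_component)
    then have "\<ominus>\<^bsub>H\<^esub> h = coh_scale K (- 1) h"
      using h by (intro H.minus_equality) (auto simp: H_simps degree_iff coh_scale_closed)
    then show "\<ominus>\<^bsub>H\<^esub> h \<in> persistence_degree K d"
      using h by (simp add: degree_iff coh_scale_closed coh_scale class_scale_zero)
  next
    fix h h' :: "('g, 'v, 'k) coh"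
    assume "h \<in> persistence_degree K d" "h' \<in> persistence_degree K d"
    then show "h \<oplus>\<^bsub>H\<^esub> h' \<in> persistence_degree K d"
      by (simp add: H_simps degree_iff coh_add class_add_zero coh_zero_in)
  qed
qed

lemma H_direct_sum: "internal_direct_sum H (persistence_degree K)"
  unfolding internal_direct_sum_def
proof (intro conjI allI ballI H_subgroup_degree)
  fix h assume "h \<in> carrier H"
  then have h: "h \<in> carrier G" by (simp add: H_simps)
  define c where "c = (\<lambda>d a n. if a = - d then h a n else zero_class a n)"
  have "coh_support K (c d) \<subseteq> coh_support K h" for d by (auto simp: c_def coh_support_def)
  then have cd: "c d \<in> persistence_degree K d" for d
    using h finite_subset[OF _ coh_finite_support[OF h]]
    by (auto simp: degree_iff coh_carrier_iff c_def coh_zero_in)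
  \<comment> \<open>In any homogeneous decomposition, only the summand of degree - a is seen at the
    object a. Applied to \<open>c\<close> this gives existence, and applied to an arbitrary
    \<open>e\<close> it gives uniqueness.\<close>
  have sum: "finsum G e {d. e d \<noteq> \<zero>\<^bsub>G\<^esub>} a n = e (- a) a n"
    if "\<And>d. e d \<in> persistence_degree K d" "finite {d. e d \<noteq> \<zero>\<^bsub>G\<^esub>}" for e a n
  proof -
    have "finsum G e {d. e d \<noteq> \<zero>\<^bsub>G\<^esub>} a n =
        (if - a \<in> {d. e d \<noteq> \<zero>\<^bsub>G\<^esub>} then e (- a) a n else zero_class a n)"
    proof (rule finsum_component)
      fix d assume "d \<noteq> - a"
      then have "a \<noteq> - d" by auto
      then show "e d a n = zero_class a n" using that(1) by (simp add: degree_iff)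
    qed (use that in \<open>auto simp: degree_iff\<close>)
    then show ?thesis by (auto simp: coh_zero)
  qed
  have "{d. c d \<noteq> \<zero>\<^bsub>G\<^esub>} \<subseteq> (\<lambda>(a, n). - a) ` coh_support K h"
  proof clarify
    fix d assume "c d \<noteq> \<zero>\<^bsub>G\<^esub>"
    then obtain a n where "c d a n \<noteq> zero_class a n" by (auto simp: fun_eq_iff coh_zero)
    then have "a = - d" "(a, n) \<in> coh_support K h"
      by (auto simp: c_def coh_support_def split: if_splits)
    then show "d \<in> (\<lambda>(a, n). - a) ` coh_support K h" by (intro image_eqI[of _ _ "(a, n)"]) simp_all
  qed
  then have fin: "finite {d. c d \<noteq> \<zero>\<^bsub>G\<^esub>}"
    using coh_finite_support[OF h] by (rule finite_subset[OF _ finite_imageI])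
  show "\<exists>!c. (\<forall>d. c d \<in> persistence_degree K d) \<and> finite {d. c d \<noteq> \<zero>\<^bsub>H\<^esub>} \<and>
      h = (\<Oplus>\<^bsub>H\<^esub>d\<in>{d. c d \<noteq> \<zero>\<^bsub>H\<^esub>}. c d)"
    unfolding H_simps
  proof (intro ex1I conjI allI)
    show "h = finsum G c {d. c d \<noteq> \<zero>\<^bsub>G\<^esub>}"
      by (intro ext) (simp only: sum[OF cd fin], simp add: c_def)
  next
    fix e assume e: "(\<forall>d. e d \<in> persistence_degree K d) \<and> finite {d. e d \<noteq> \<zero>\<^bsub>G\<^esub>} \<and>
      h = finsum G e {d. e d \<noteq> \<zero>\<^bsub>G\<^esub>}"
    then have "h a n = e (- a) a n" for a n using sum[of e a n] by auto
    then show "e = c" using e by (auto simp: fun_eq_iff c_def degree_iff)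
  qed (use cd fin in auto)
qed

lemma act_degree:
  assumes r: "r \<in> persistence_ring_degree S x" and h: "h \<in> persistence_degree K a"
  shows "act r h \<in> persistence_degree K (a + x)"
proof -
  have rR: "r \<in> carrier R" using r by (simp add: persistence_ring_degree_def)
  have hG: "h \<in> carrier G" using h by (simp add: degree_iff)
  show ?thesis
  proof (cases "x \<in> S")
    case True
    have "act r h = coh_scale K (Poly_Mapping.lookup r x) (persist K \<phi> x h)"
      using act_eq[of "{x}" r h] r True hG
      by (simp add: persistence_ring_degree_def act_term_closed)
    moreover have "h (x + b) n = zero_class (x + b) n" if "b \<noteq> - (a + x)" for b n
    proof -
      have "x + b \<noteq> - a"
      proof
        assume "x + b = - a"
        then have "x + b - x = - a - x" by (simp only:)
        then show False using that by simp
      qed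
      then show ?thesis using h by (simp add: degree_iff)
    qed
    moreover have "cay_le S b (x + b)" for b using True by (simp add: cay_le_def)
    ultimately show ?thesis
      using rR hG act_closed[OF rR hG]
      by (simp add: degree_iff coh_scale persist_def res_zero class_scale_zero)
  next
    \<comment> \<open>Degrees outside \<open>S\<close> are allowed, but the ring is zero
      there.\<close>
    case False
    then have "Poly_Mapping.keys r = {}"
      using r unfolding persistence_ring_degree_def R_carrier_iff by blast
    then show ?thesis by (simp add: act_zero_left degree_iff coh_zero)
  qed
qed

lemma R_degree_iff:
  "r \<in> persistence_ring_degree S x \<longleftrightarrow> r \<in> carrier R \<and> Poly_Mapping.keys r \<subseteq> {x}"
  by (simp add: persistence_ring_degree_def)

lemma R_subgroup_degree:
  "subgroup (persistence_ring_degree S x :: ('g \<Rightarrow>\<^sub>0 'k) set) (add_monoid R)"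
proof (rule R.add.subgroupI)
  show "persistence_ring_degree S x \<subseteq> carrier R" by (auto simp: R_degree_iff)
  have "(0 :: 'g \<Rightarrow>\<^sub>0 'k) \<in> persistence_ring_degree S x" by (simp add: R_degree_iff R_carrier_iff)
  then show "(persistence_ring_degree S x :: ('g \<Rightarrow>\<^sub>0 'k) set) \<noteq> {}" by blast
next
  fix r :: "'g \<Rightarrow>\<^sub>0 'k" assume r: "r \<in> persistence_ring_degree S x"
  then have "\<ominus>\<^bsub>R\<^esub> r = - r"
    by (intro R.minus_equality) (auto simp: R_simps R_degree_iff R_carrier_iff)
  then show "\<ominus>\<^bsub>R\<^esub> r \<in> persistence_ring_degree S x"
    using r by (simp add: R_degree_iff R_carrier_iff)
next
  fix r s :: "'g \<Rightarrow>\<^sub>0 'k"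
  assume "r \<in> persistence_ring_degree S x" "s \<in> persistence_ring_degree S x"
  then show "r \<oplus>\<^bsub>R\<^esub> s \<in> persistence_ring_degree S x"
    using Poly_Mapping.keys_add[of r s] by (auto simp: R_simps R_degree_iff R_add_closed)
qed

lemma R_degree_lookup:
  fixes r :: "'g \<Rightarrow>\<^sub>0 'k"
  assumes "r \<in> persistence_ring_degree S x" "x \<noteq> y"
  shows "Poly_Mapping.lookup r y = 0"
proof -
  have "y \<notin> Poly_Mapping.keys r" using assms unfolding R_degree_iff by blast
  then show ?thesis by (simp add: not_in_keys_iff_lookup_eq_zero)
qed

text \<open>The same pattern as in \<open>H_direct_sum\<close>: the coefficient at y of a
  homogeneous decomposition comes from its summand of degree y alone.\<close>

lemma R_direct_sum: "internal_direct_sum R (persistence_ring_degree S)"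
  unfolding internal_direct_sum_def
proof (intro conjI allI ballI R_subgroup_degree)
  fix r assume r: "r \<in> carrier R"
  define c where "c = (\<lambda>x. Poly_Mapping.single x (Poly_Mapping.lookup r x))"
  have cx: "c x \<in> persistence_ring_degree S x" for x
  proof (cases "Poly_Mapping.lookup r x = 0")
    case True
    then show ?thesis by (simp add: c_def R_degree_iff R_carrier_iff)
  next
    case False
    then have "x \<in> S" using r unfolding R_carrier_iff by (meson in_keys_iff subsetD)
    then show ?thesis by (simp add: c_def R_degree_iff R_single_closed)
  qed
  have "{x. c x \<noteq> 0} \<subseteq> Poly_Mapping.keys r" by (auto simp: c_def in_keys_iff)
  then have fin: "finite {x. c x \<noteq> 0}" by (rule finite_subset[OF _ finite_keys])
  have sum: "finsum R e {x. e x \<noteq> 0} = sum e {x. e x \<noteq> 0}"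
    "Poly_Mapping.lookup (sum e {x. e x \<noteq> 0}) y = Poly_Mapping.lookup (e y) y"
    if e: "\<And>x. e x \<in> persistence_ring_degree S x" "finite {x. e x \<noteq> 0}" for e y
  proof -
    show "finsum R e {x. e x \<noteq> 0} = sum e {x. e x \<noteq> 0}"
      using e by (intro R_finsum) (auto simp: R_degree_iff)
    have "Poly_Mapping.lookup (e x) y = (if x = y then Poly_Mapping.lookup (e y) y else 0)" for x
      using R_degree_lookup[OF e(1)] by simp
    then have "Poly_Mapping.lookup (sum e {x. e x \<noteq> 0}) y =
        (\<Sum>x\<in>{x. e x \<noteq> 0}. if x = y then Poly_Mapping.lookup (e y) y else 0)"
      unfolding lookup_sum by (intro sum.cong refl)
    also have "\<dots> = Poly_Mapping.lookup (e y) y" using e(2) by simp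
    finally show "Poly_Mapping.lookup (sum e {x. e x \<noteq> 0}) y = Poly_Mapping.lookup (e y) y" .
  qed
  show "\<exists>!c. (\<forall>x. c x \<in> persistence_ring_degree S x) \<and> finite {x. c x \<noteq> \<zero>\<^bsub>R\<^esub>} \<and>
      r = (\<Oplus>\<^bsub>R\<^esub>x\<in>{x. c x \<noteq> \<zero>\<^bsub>R\<^esub>}. c x)"
    unfolding R_simps
  proof (intro ex1I conjI allI)
    show "r = finsum R c {x. c x \<noteq> 0}"
      unfolding sum(1)[OF cx fin]
      by (rule poly_mapping_eqI) (simp only: sum(2)[OF cx fin], simp add: c_def)
  next
    fix e assume e: "(\<forall>x. e x \<in> persistence_ring_degree S x) \<and> finite {x. e x \<noteq> 0} \<and>
      r = finsum R e {x. e x \<noteq> 0}"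
    then have deg: "e x \<in> persistence_ring_degree S x" for x by blast
    have fin: "finite {x. e x \<noteq> 0}" using e by blast
    have "r = finsum R e {x. e x \<noteq> 0}" using e by blast
    then have eq: "Poly_Mapping.lookup r x = Poly_Mapping.lookup (e x) x" for x
      by (simp only: sum[OF deg fin])
    show "e = c"
    proof (intro ext poly_mapping_eqI)
      fix x y
      show "Poly_Mapping.lookup (e x) y = Poly_Mapping.lookup (c x) y"
        using R_degree_lookup[OF deg, of x y] R_degree_lookup[OF cx, of x y]
        by (cases "x = y") (simp_all add: eq c_def)
    qed
  qed (use cx fin in auto)
qed

lemma R_graded: "graded_cring R (persistence_ring_degree S)"
  unfolding graded_cring_def
proof (intro conjI allI ballI R_cring R_direct_sum)
  show "\<one>\<^bsub>R\<^esub> \<in> persistence_ring_degree S 0"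
    using R.one_closed by (simp add: R_degree_iff R_simps flip: single_one)
next
  fix x y and r s :: "'g \<Rightarrow>\<^sub>0 'k"
  assume "r \<in> persistence_ring_degree S x" "s \<in> persistence_ring_degree S y"
  then show "r \<otimes>\<^bsub>R\<^esub> s \<in> persistence_ring_degree S (x + y)"
    using Poly_Mapping.keys_mult[of r s] by (auto simp: R_degree_iff R_simps R_mult_closed)
qed

lemma H_graded: "graded_module R (persistence_ring_degree S) H (persistence_degree K)"
  unfolding graded_module_def by (simp add: H_module H_direct_sum H_simps act_degree)

section \<open>The twisting functions\<close>

text \<open>The class of degree a lives at \<open>- a\<close> and \<open>L\<^sub>x\<close> moves it to \<open>- a - x\<close>.\<close>

definition shift :: "'g \<Rightarrow> 'g \<Rightarrow> 'g \<Rightarrow> 'g \<Rightarrow> 'g" where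
  "shift a b x y = meet (- a) (- b) - meet (- a - x) (- b - y)"

text \<open>The bilinear extension of the map sending the basis pair x, y to the basis element at
  \<open>shift a b x y\<close>. It is not expressed through \<open>r * s\<close>, since the shift
  depends on x and y separately.\<close>

definition twist :: "'g \<Rightarrow> 'g \<Rightarrow> ('g \<Rightarrow>\<^sub>0 'k) \<Rightarrow> ('g \<Rightarrow>\<^sub>0 'k) \<Rightarrow> ('g \<Rightarrow>\<^sub>0 'k)" where
  "twist a b r s = (\<Sum>x \<in> Poly_Mapping.keys r. \<Sum>y \<in> Poly_Mapping.keys s.
     Poly_Mapping.single (shift a b x y) (Poly_Mapping.lookup r x * Poly_Mapping.lookup s y))"

text \<open>Monotonicity of the meet is what keeps the twisting functions inside the monoid
  ring.\<close>

lemma shift_in_S: "x \<in> S \<Longrightarrow> y \<in> S \<Longrightarrow> shift a b x y \<in> S"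
  using meet_mono[OF cay_le_minus cay_le_minus, of x y "- a" "- b"]
  by (simp add: cay_le_def shift_def)

lemma twist_closed:
  assumes "r \<in> carrier R" "s \<in> carrier R"
  shows "twist a b r s \<in> carrier R"
  unfolding twist_def
  by (intro R_sum_closed finite_keys Pi_I R_single_closed shift_in_S)
    (use assms in \<open>auto simp: R_carrier_iff\<close>)

text \<open>As for the action, larger index sets add only zero terms and allow sums with cancelling
  keys to be compared.\<close>

lemma twist_eq:
  assumes "finite A" "Poly_Mapping.keys r \<subseteq> A" "finite B" "Poly_Mapping.keys s \<subseteq> B"
  shows "twist a b r s = (\<Sum>x \<in> A. \<Sum>y \<in> B.
    Poly_Mapping.single (shift a b x y) (Poly_Mapping.lookup r x * Poly_Mapping.lookup s y))"
proof -
  have "twist a b r s = (\<Sum>x \<in> Poly_Mapping.keys r. \<Sum>y \<in> B.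
      Poly_Mapping.single (shift a b x y) (Poly_Mapping.lookup r x * Poly_Mapping.lookup s y))"
    unfolding twist_def using assms(3,4)
    by (intro sum.cong sum.mono_neutral_left refl) (auto simp: in_keys_iff)
  also have "\<dots> = (\<Sum>x \<in> A. \<Sum>y \<in> B.
      Poly_Mapping.single (shift a b x y) (Poly_Mapping.lookup r x * Poly_Mapping.lookup s y))"
    using assms(1,2) by (intro sum.mono_neutral_left) (auto simp: in_keys_iff)
  finally show ?thesis .
qed

lemma twist_add_left: "twist a b (r + r') s = twist a b r s + twist a b r' s"
  using twist_eq[of "Poly_Mapping.keys r \<union> Poly_Mapping.keys r'" _ "Poly_Mapping.keys s" s a b]
    Poly_Mapping.keys_add[of r r']
  by (simp add: lookup_add distrib_right single_add sum.distrib)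

lemma twist_add_right: "twist a b r (s + s') = twist a b r s + twist a b r s'"
  using twist_eq[of "Poly_Mapping.keys r" r "Poly_Mapping.keys s \<union> Poly_Mapping.keys s'" _ a b]
    Poly_Mapping.keys_add[of s s']
  by (simp add: lookup_add distrib_left single_add sum.distrib)

lemma twist_single: "twist a b (Poly_Mapping.single x t) (Poly_Mapping.single y u) =
    Poly_Mapping.single (shift a b x y) (t * u)"
  using twist_eq[of "{x}" "Poly_Mapping.single x t" "{y}" "Poly_Mapping.single y u" a b] by simp

lemma twist_zero_left: "twist a b 0 s = 0"
  and twist_zero_right: "twist a b r 0 = 0"
  by (simp_all add: twist_def)

text \<open>Only an inclusion, since \<open>t\<close> may be 0; with \<open>twist_eq\<close> the
  sums still run over the keys of the unscaled element.\<close>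

lemma keys_single_zero_times:
  "Poly_Mapping.keys (Poly_Mapping.single 0 t * r) \<subseteq> Poly_Mapping.keys r" for r :: "'g \<Rightarrow>\<^sub>0 'k"
  by (auto simp: in_keys_iff lookup_single_zero_times)

lemma twist_scale_left:
  "twist a b (Poly_Mapping.single 0 t * r) s = Poly_Mapping.single 0 t * twist a b r s"
  using twist_eq[OF finite_keys keys_single_zero_times finite_keys order.refl]
  by (simp add: lookup_single_zero_times twist_def[of a b r] sum_distrib_left mult_single mult.assoc)

lemma twist_scale_right:
  "twist a b r (Poly_Mapping.single 0 t * s) = Poly_Mapping.single 0 t * twist a b r s"
  using twist_eq[OF finite_keys order.refl finite_keys keys_single_zero_times]
  by (simp add: lookup_single_zero_times twist_def[of a b r s] sum_distrib_left mult_single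
      mult.left_commute)

lemma twist_bilinear: "bilinear_over R persistence_ring_scalars (twist a b)"
  unfolding bilinear_over_def persistence_ring_scalars_def
  by (auto simp: R_simps twist_closed twist_add_left twist_add_right twist_scale_left
      twist_scale_right)

text \<open>Homogeneity fixes the objects - a and - b and thereby the shift. The ring arguments are
  reduced first, so that \<open>twist\<close> collapses to one basis element before \<open>u\<close>
  and \<open>v\<close> are decomposed.\<close>

lemma cup_act:
  assumes r: "r \<in> carrier R" and s: "s \<in> carrier R"
    and u: "u \<in> persistence_degree K a" and v: "v \<in> persistence_degree K b"
  shows "cup (act r u) (act s v) = act (twist a b r s) (cup u v)"
proof -
  have uG: "u \<in> carrier G" and vG: "v \<in> carrier G" using u v by (simp_all add: degree_iff)
  show ?thesis using r
  proof (induction r rule: R_induct)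
    case zero
    then show ?case using s vG by (simp add: act_zero_left twist_zero_left cup_zero_left act_closed)
  next
    case (add r r')
    then show ?case
      using s uG vG
        by (simp add: act_add_left twist_add_left cup_add_left act_closed cup_closed twist_closed)
  next
    case x: (single x t)
    show ?case using s
    proof (induction s rule: R_induct)
      case zero
      then show ?case
        using x uG
          by (simp add: act_zero_left twist_zero_right cup_zero_right act_closed R_single_closed)
    next
      case (add s s')
      then show ?case using x uG vG
        by (simp add: act_add_left twist_add_right cup_add_right act_closed cup_closed twist_closed
            R_single_closed)
    next
      case y: (single y t')
      have xy: "Poly_Mapping.single x t \<in> carrier R" "Poly_Mapping.single y t' \<in> carrier R"
        "Poly_Mapping.single (shift a b x y) (t * t') \<in> carrier R"
        using x y by (simp_all add: R_single_closed shift_in_S)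
      show ?case unfolding twist_single using u
      proof (induction u rule: degree_induct)
        case zero
        then show ?case using xy vG by (simp add: act_zero_right cup_zero_left act_closed)
      next
        case (add u u')
        then show ?case using xy vG by (simp add: act_add_right cup_add_left act_closed cup_closed)
      next
        case X: (inj p X)
        show ?case using v
        proof (induction v rule: degree_induct)
          case zero
          then show ?case using xy X
            by (simp add: act_zero_right cup_zero_right act_closed inj_closed)
        next
          case (add v v')
          then show ?case using xy X
            by (simp add: act_add_right cup_add_right act_closed cup_closed inj_closed)
        next
          case Y: (inj q Y)
          have le: "cay_le S (- a - x) (- a)" "cay_le S (- b - y) (- b)"
            using x y by (auto intro: cay_le_minus)
          \<comment> \<open>Identifies where the right side lands: the product at the larger meet,
            moved by the shift, arrives at the object of the left side.\<close>
          have "meet (- a) (- b) - shift a b x y = meet (- a - x) (- b - y)"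
            by (simp add: shift_def)
          then show ?case
            using x y X Y le
            by (simp add: act_single_inj cup_inj res_closed class_scale_closed shift_in_S pcup_closed
                pcup_scale_res)
        qed
      qed
    qed
  qed
qed

lemma H_twisted_algebra:
  "graded_twisted_algebra R persistence_ring_scalars (persistence_ring_degree S)
    H (persistence_degree K) twist"
  unfolding graded_twisted_algebra_def
  by (simp add: R_graded H_graded H_simps cup_closed cup_add_left cup_add_right cup_assoc
      twist_bilinear cup_act)

section \<open>Products of finite linear combinations\<close>

lemma cup_finsum_left:
  "finite J \<Longrightarrow> F \<in> J \<rightarrow> carrier G \<Longrightarrow> h \<in> carrier G \<Longrightarrow>
    cup (finsum G F J) h = finsum G (\<lambda>i. cup (F i) h) J"
  by (induction J rule: finite_induct) (simp_all add: cup_zero_left cup_add_left cup_closed Pi_def)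

lemma cup_finsum_right:
  "finite J \<Longrightarrow> F \<in> J \<rightarrow> carrier G \<Longrightarrow> h \<in> carrier G \<Longrightarrow>
    cup h (finsum G F J) = finsum G (\<lambda>i. cup h (F i)) J"
  by (induction J rule: finite_induct)
    (simp_all add: cup_zero_right cup_add_right cup_closed Pi_def)

text \<open>Biadditivity expands the product into pairs, and \<open>cup_act\<close> extracts the
  coefficients of each pair. This is how products of generators determine all products.\<close>

lemma cup_finsum_act:
  assumes J: "finite J" "finite J'" and r: "r \<in> J \<rightarrow> carrier R" and s: "s \<in> J' \<rightarrow> carrier R"
    and g: "\<And>i. i \<in> J \<union> J' \<Longrightarrow> g i \<in> persistence_degree K (d i)"
  shows "cup (\<Oplus>\<^bsub>G\<^esub> i \<in> J. act (r i) (g i)) (\<Oplus>\<^bsub>G\<^esub> j \<in> J'. act (s j) (g j)) =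
    (\<Oplus>\<^bsub>G\<^esub> i \<in> J. \<Oplus>\<^bsub>G\<^esub> j \<in> J'. act (twist (d i) (d j) (r i) (s j)) (cup (g i) (g j)))"
proof -
  have gG: "g i \<in> carrier G" if "i \<in> J \<union> J'" for i using g[OF that] by (simp add: degree_iff)
  have rg: "(\<lambda>i. act (r i) (g i)) \<in> J \<rightarrow> carrier G" and sg: "(\<lambda>j. act (s j) (g j)) \<in> J' \<rightarrow> carrier G"
    using r s gG by (auto intro!: act_closed)
  have "cup (\<Oplus>\<^bsub>G\<^esub> i \<in> J. act (r i) (g i)) (\<Oplus>\<^bsub>G\<^esub> j \<in> J'. act (s j) (g j)) =
      (\<Oplus>\<^bsub>G\<^esub> i \<in> J. cup (act (r i) (g i)) (\<Oplus>\<^bsub>G\<^esub> j \<in> J'. act (s j) (g j)))"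
    by (rule cup_finsum_left[OF J(1) rg G.finsum_closed[OF sg]])
  also have "\<dots> =
      (\<Oplus>\<^bsub>G\<^esub> i \<in> J. \<Oplus>\<^bsub>G\<^esub> j \<in> J'. act (twist (d i) (d j) (r i) (s j)) (cup (g i) (g j)))"
  proof (rule G.finsum_cong')
    have cl: "act (twist (d i) (d j) (r i) (s j)) (cup (g i) (g j)) \<in> carrier G"
      if "i \<in> J" "j \<in> J'" for i j
      using that r s gG by (intro act_closed twist_closed cup_closed) auto
    then show "(\<lambda>i. \<Oplus>\<^bsub>G\<^esub> j \<in> J'. act (twist (d i) (d j) (r i) (s j)) (cup (g i) (g j)))
        \<in> J \<rightarrow> carrier G"
      by (intro Pi_I G.finsum_closed)
    fix i assume i: "i \<in> J"
    then have "act (r i) (g i) \<in> carrier G" using rg by blast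
    then have "cup (act (r i) (g i)) (\<Oplus>\<^bsub>G\<^esub> j \<in> J'. act (s j) (g j)) =
        (\<Oplus>\<^bsub>G\<^esub> j \<in> J'. cup (act (r i) (g i)) (act (s j) (g j)))"
      by (rule cup_finsum_right[OF J(2) sg])
    also have "\<dots> = (\<Oplus>\<^bsub>G\<^esub> j \<in> J'. act (twist (d i) (d j) (r i) (s j)) (cup (g i) (g j)))"
      using i cl r s g by (intro G.finsum_cong' Pi_I cup_act refl) auto
    finally show "cup (act (r i) (g i)) (\<Oplus>\<^bsub>G\<^esub> j \<in> J'. act (s j) (g j)) =
        (\<Oplus>\<^bsub>G\<^esub> j \<in> J'. act (twist (d i) (d j) (r i) (s j)) (cup (g i) (g j)))" .
  qed simp
  finally show ?thesis .
qed

end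

theorem theorem1p3:
  fixes S :: "'g::ab_group_add set"
    and K :: "'g \<Rightarrow> 'v set set"
    and \<phi> :: "'g \<Rightarrow> 'g \<Rightarrow> 'v \<Rightarrow> 'v"
    and R :: "('g \<Rightarrow>\<^sub>0 'k::field) ring"
    and H :: "('g \<Rightarrow>\<^sub>0 'k, ('g, 'v, 'k) coh) module"
  assumes "0 \<in> S" and "\<And>x y. x \<in> S \<Longrightarrow> y \<in> S \<Longrightarrow> x + y \<in> S"
    and "\<And>x. x \<in> S \<Longrightarrow> - x \<in> S \<Longrightarrow> x = 0"
    and "\<And>b c. \<exists>m. is_cay_product S b c m"
    and "cayley_persistence_complex S K \<phi>"
    and "\<And>a. finite_dimensional_homology TYPE('k) (K a)"
    and "R = persistence_ring S"
    and "H = persistence_cohomology S K \<phi>"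
  shows "\<exists>f. graded_twisted_algebra R persistence_ring_scalars (persistence_ring_degree S)
               H (persistence_degree K) f \<and>
           (\<forall>(I :: 'i set) g d. module_generators R H I g \<and> (\<forall>i \<in> I. g i \<in> persistence_degree K (d i)) \<longrightarrow>
              (\<forall>J J' r s. finite J \<and> J \<subseteq> I \<and> finite J' \<and> J' \<subseteq> I \<and>
                 r \<in> J \<rightarrow> carrier R \<and> s \<in> J' \<rightarrow> carrier R \<longrightarrow>
                 (\<Oplus>\<^bsub>H\<^esub> i \<in> J. r i \<odot>\<^bsub>H\<^esub> g i) \<otimes>\<^bsub>H\<^esub> (\<Oplus>\<^bsub>H\<^esub> j \<in> J'. s j \<odot>\<^bsub>H\<^esub> g j) =
                 (\<Oplus>\<^bsub>H\<^esub> i \<in> J. \<Oplus>\<^bsub>H\<^esub> j \<in> J'. f (d i) (d j) (r i) (s j) \<odot>\<^bsub>H\<^esub> (g i \<otimes>\<^bsub>H\<^esub> g j))))"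
proof -
  interpret P: cayley_persistence S K \<phi> "TYPE('k)"
    using assms by unfold_locales
  show ?thesis
    unfolding assms(7,8)
  \<comment> \<open>The witness is chosen before the generators, so the same twisting functions
    serve every generating family.\<close>
  proof (intro exI[of _ P.twist] conjI P.H_twisted_algebra allI impI)
    fix I :: "'i set" and g d J J' and r s :: "'i \<Rightarrow> 'g \<Rightarrow>\<^sub>0 'k"
    assume gen: "module_generators P.R P.H I g \<and> (\<forall>i \<in> I. g i \<in> persistence_degree K (d i))"
      and J: "finite J \<and> J \<subseteq> I \<and> finite J' \<and> J' \<subseteq> I \<and>
        r \<in> J \<rightarrow> carrier P.R \<and> s \<in> J' \<rightarrow> carrier P.R"
    then show "(\<Oplus>\<^bsub>P.H\<^esub> i \<in> J. r i \<odot>\<^bsub>P.H\<^esub> g i) \<otimes>\<^bsub>P.H\<^esub> (\<Oplus>\<^bsub>P.H\<^esub> j \<in> J'. s j \<odot>\<^bsub>P.H\<^esub> g j) =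
        (\<Oplus>\<^bsub>P.H\<^esub> i \<in> J. \<Oplus>\<^bsub>P.H\<^esub> j \<in> J'. P.twist (d i) (d j) (r i) (s j) \<odot>\<^bsub>P.H\<^esub> (g i \<otimes>\<^bsub>P.H\<^esub> g j))"
      unfolding P.H_simps by (intro P.cup_finsum_act) blast+
  qed
qed

end
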